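(* Let $\mathcal{C}$ be a congruence-modular equational class, let $A,B$ be algebras from $\mathcal{C}$ and let $f:A\to B$ be a morphism in $\mathcal{C}$. For each $\beta\in\mathrm{Con}(B)$, let $f_\beta:A/f^*(\beta)\to B/\beta$ be the morphism given by $f_\beta(a/f^*(\beta))=f(a)/\beta$ for all $a\in A$. If $\nabla_B$ is finitely generated and $f$ is admissible, then the following are equivalent: (1) $f$ fulfills GU; (2) for all $\beta\in\mathrm{Spec}(B)$, the map $f_\beta^*|_{\mathrm{Spec}(B/\beta)}:\mathrm{Spec}(B/\beta)\to\mathrm{Spec}(A/f^*(\beta))$ is surjective; (3) the map $f^*|_{\mathrm{Spec}(B)}:\mathrm{Spec}(B)\to\mathrm{Spec}(A)$ is closed with respect to the Stone topologies; (4) for all $\beta\in\mathrm{Con}(B)$, $f_\beta$ fulfills GU; (5) for all $\beta\in\mathrm{Con}(B)$, $f_\beta$ fulfills LO; (6) for all $\beta\in\mathrm{Spec}(B)$, $f_\beta$ fulfills GU; (7) for all $\beta\in\mathrm{Spec}(B)$, $f_\beta$ fulfills LO. Moreover, if $f$ is admissible, then (1), (2), (4) and (7) are equivalent even if $\nabla_B$ is not finitely generated.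
   Context: An equational class (variety) $\mathcal{C}$ of algebras of a fixed type is congruence-modular if the congruence lattice $\mathrm{Con}(M)$ is modular for every member $M$ of $\mathcal{C}$. All algebras are non-empty; a morphism in $\mathcal{C}$ is a homomorphism between members of $\mathcal{C}$. For an algebra $M$, $\Delta_M$ is the equality relation and $\nabla_M=M^2$; a congruence is finitely generated if it is the least congruence containing some finite subset of $M^2$. In a congruence-modular class, the commutator $[\alpha,\beta]_M$ of $\alpha,\beta\in\mathrm{Con}(M)$ is the (Freese--McKenzie) modular commutator, i.e. the smallest congruence $\delta$ of $M$ such that, for every term $t(\bar x,\bar y)$ and all tuples $\bar a,\bar b,\bar c,\bar d$ of elements of $M$ with $(a_i,b_i)\in\alpha$ for all $i$ and $(c_j,d_j)\in\beta$ for all $j$, $(t(\bar a,\bar c),t(\bar a,\bar d))\in\delta$ implies $(t(\bar b,\bar c),t(\bar b,\bar d))\in\delta$. A congruence $\phi\neq\nabla_M$ is prime if, for all $\alpha,\beta\in\mathrm{Con}(M)$, $[\alpha,\beta]_M\subseteq\phi$ implies $\alpha\subseteq\phi$ or $\beta\subseteq\phi$; $\mathrm{Spec}(M)$ is the set of prime congruences of $M$. The Stone topology on $\mathrm{Spec}(M)$ is the one whose closed sets are the sets $V_M(\theta)=\{\phi\in\mathrm{Spec}(M) : \theta\subseteq\phi\}$, $\theta\in\mathrm{Con}(M)$. For a morphism $f:A\to B$ and $\psi\in\mathrm{Con}(B)$, $f^*(\psi)=\{(x,y)\in A^2 : (f(x),f(y))\in\psi\}\in\mathrm{Con}(A)$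 and $\mathrm{Ker}(f)=f^*(\Delta_B)$. $f$ is admissible if $f^*(\psi)\in\mathrm{Spec}(A)$ for all $\psi\in\mathrm{Spec}(B)$; if $f$ is admissible, then so is every $f_\beta$ (so that the maps in (2) are well defined). An admissible morphism $f:A\to B$ fulfills GU (Going Up) if for all $\phi,\psi\in\mathrm{Spec}(A)$ and $\phi_1\in\mathrm{Spec}(B)$ with $\phi\subseteq\psi$ and $f^*(\phi_1)=\phi$ there is $\psi_1\in\mathrm{Spec}(B)$ with $\phi_1\subseteq\psi_1$ and $f^*(\psi_1)=\psi$; it fulfills LO (Lying Over) if for every $\phi\in\mathrm{Spec}(A)$ with $\mathrm{Ker}(f)\subseteq\phi$ there is $\phi_1\in\mathrm{Spec}(B)$ with $f^*(\phi_1)=\phi$. *)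

theory Defs
  imports "HOL-Analysis.Abstract_Topology"
begin

section \<open>Algebras of a fixed type, terms, equational classes\<close>

text \<open>
  A type of algebras is a partial map sending each operation symbol to its (finite) arity;
  symbols mapped to \<open>None\<close> do not belong to the type.
\<close>

type_synonym 'f signat = "'f \<Rightarrow> nat option"

datatype ('f, 'v) trm = Var 'v | Op 'f "('f, 'v) trm list"

fun wf_trm :: "'f signat \<Rightarrow> ('f, 'v) trm \<Rightarrow> bool" where
  "wf_trm \<sigma> (Var v) \<longleftrightarrow> True"
| "wf_trm \<sigma> (Op f ts) \<longleftrightarrow> \<sigma> f = Some (length ts) \<and> (\<forall>t\<in>set ts. wf_trm \<sigma> t)"

record ('f, 'a) alg =
  carr :: "'a set"
  oper :: "'f \<Rightarrow> 'a list \<Rightarrow> 'a"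

definition is_alg :: "'f signat \<Rightarrow> ('f, 'a) alg \<Rightarrow> bool" where
  "is_alg \<sigma> M \<longleftrightarrow> carr M \<noteq> {} \<and>
     (\<forall>f xs. \<sigma> f = Some (length xs) \<and> set xs \<subseteq> carr M \<longrightarrow> oper M f xs \<in> carr M)"

fun eval_trm :: "('f, 'a) alg \<Rightarrow> ('v \<Rightarrow> 'a) \<Rightarrow> ('f, 'v) trm \<Rightarrow> 'a" where
  "eval_trm M v (Var x) = v x"
| "eval_trm M v (Op f ts) = oper M f (map (eval_trm M v) ts)"

type_synonym 'f identities = "(('f, nat) trm \<times> ('f, nat) trm) set"

definition wf_identities :: "'f signat \<Rightarrow> 'f identities \<Rightarrow> bool" where
  "wf_identities \<sigma> E \<longleftrightarrow> (\<forall>(s, t)\<in>E. wf_trm \<sigma> s \<and> wf_trm \<sigma> t)"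

text \<open>Membership in the equational class axiomatised by \<open>E\<close>:\<close>

definition in_class :: "'f signat \<Rightarrow> 'f identities \<Rightarrow> ('f, 'a) alg \<Rightarrow> bool" where
  "in_class \<sigma> E M \<longleftrightarrow> is_alg \<sigma> M \<and>
     (\<forall>(s, t)\<in>E. \<forall>v. range v \<subseteq> carr M \<longrightarrow> eval_trm M v s = eval_trm M v t)"

definition morphism :: "'f signat \<Rightarrow> ('f, 'a) alg \<Rightarrow> ('f, 'b) alg \<Rightarrow> ('a \<Rightarrow> 'b) \<Rightarrow> bool" where
  "morphism \<sigma> A B h \<longleftrightarrow> h ` carr A \<subseteq> carr B \<and>
     (\<forall>f xs. \<sigma> f = Some (length xs) \<and> set xs \<subseteq> carr A \<longrightarrow>
        h (oper A f xs) = oper B f (map h xs))"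


section \<open>Congruences\<close>

definition Con :: "'f signat \<Rightarrow> ('f, 'a) alg \<Rightarrow> ('a \<times> 'a) set set" where
  "Con \<sigma> M = {\<theta>. equiv (carr M) \<theta> \<and>
     (\<forall>f xs ys. \<sigma> f = Some (length xs) \<and> list_all2 (\<lambda>x y. (x, y) \<in> \<theta>) xs ys \<longrightarrow>
        (oper M f xs, oper M f ys) \<in> \<theta>)}"

definition Nabla :: "('f, 'a) alg \<Rightarrow> ('a \<times> 'a) set" where
  "Nabla M = carr M \<times> carr M"

definition Delta :: "('f, 'a) alg \<Rightarrow> ('a \<times> 'a) set" where
  "Delta M = Id_on (carr M)"

definition Cg :: "'f signat \<Rightarrow> ('f, 'a) alg \<Rightarrow> ('a \<times> 'a) set \<Rightarrow> ('a \<times> 'a) set" where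
  "Cg \<sigma> M S = \<Inter> {\<theta> \<in> Con \<sigma> M. S \<subseteq> \<theta>}"

definition fin_generated :: "'f signat \<Rightarrow> ('f, 'a) alg \<Rightarrow> ('a \<times> 'a) set \<Rightarrow> bool" where
  "fin_generated \<sigma> M \<theta> \<longleftrightarrow> (\<exists>S. finite S \<and> S \<subseteq> carr M \<times> carr M \<and> \<theta> = Cg \<sigma> M S)"

text \<open>Modularity of the lattice \<open>Con \<sigma> M\<close>: meets are intersections, joins are generated by unions.\<close>

definition con_modular :: "'f signat \<Rightarrow> ('f, 'a) alg \<Rightarrow> bool" where
  "con_modular \<sigma> M \<longleftrightarrow>
     (\<forall>\<alpha>\<in>Con \<sigma> M. \<forall>\<beta>\<in>Con \<sigma> M. \<forall>\<gamma>\<in>Con \<sigma> M. \<gamma> \<subseteq> \<alpha> \<longrightarrow>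
        \<alpha> \<inter> Cg \<sigma> M (\<beta> \<union> \<gamma>) = Cg \<sigma> M ((\<alpha> \<inter> \<beta>) \<union> \<gamma>))"

text \<open>
  HOL cannot quantify over all types inside a formula, so the members of the class are taken here
  with carriers inside the type of terms over countably many variables. This is no restriction:
  by \<open>congruence_modular_all\<close> below, the members of the class over every other type then have
  modular congruence lattices as well.
\<close>

definition congruence_modular :: "'f signat \<Rightarrow> 'f identities \<Rightarrow> bool" where
  "congruence_modular \<sigma> E \<longleftrightarrow>
     (\<forall>M :: ('f, ('f, nat) trm) alg. in_class \<sigma> E M \<longrightarrow> con_modular \<sigma> M)"

definition quot_alg :: "('f, 'a) alg \<Rightarrow> ('a \<times> 'a) set \<Rightarrow> ('f, 'a set) alg" where
  "quot_alg M \<theta> = \<lparr>carr = carr M // \<theta>,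
     oper = (\<lambda>f Xs. \<theta> `` {oper M f (map (\<lambda>X. SOME x. x \<in> X) Xs)})\<rparr>"


section \<open>Commutator and prime congruences\<close>

text \<open>
  The term condition for \<open>\<alpha>, \<beta>\<close> modulo \<open>\<delta>\<close>. The variables \<open>Inl i\<close> and \<open>Inr j\<close> play the roles of
  \<open>x\<^sub>i\<close> and \<open>y\<^sub>j\<close>. The tuples are sequences, only finitely many entries of which occur in \<open>t\<close>;
  as the carrier is non-empty, every finite tuple extends to such a sequence.
\<close>

definition term_condition ::
  "'f signat \<Rightarrow> ('f, 'a) alg \<Rightarrow> ('a \<times> 'a) set \<Rightarrow> ('a \<times> 'a) set \<Rightarrow> ('a \<times> 'a) set \<Rightarrow> bool" where
  "term_condition \<sigma> M \<alpha> \<beta> \<delta> \<longleftrightarrow>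
     (\<forall>t :: ('f, nat + nat) trm. \<forall>a b c d. wf_trm \<sigma> t \<and>
        (\<forall>i. (a i, b i) \<in> \<alpha>) \<and> (\<forall>j. (c j, d j) \<in> \<beta>) \<and>
        (eval_trm M (case_sum a c) t, eval_trm M (case_sum a d) t) \<in> \<delta> \<longrightarrow>
        (eval_trm M (case_sum b c) t, eval_trm M (case_sum b d) t) \<in> \<delta>)"

text \<open>The smallest such congruence; see \<open>commutator_least\<close> below.\<close>

definition commutator ::
  "'f signat \<Rightarrow> ('f, 'a) alg \<Rightarrow> ('a \<times> 'a) set \<Rightarrow> ('a \<times> 'a) set \<Rightarrow> ('a \<times> 'a) set" where
  "commutator \<sigma> M \<alpha> \<beta> = \<Inter> {\<delta> \<in> Con \<sigma> M. term_condition \<sigma> M \<alpha> \<beta> \<delta>}"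

definition Spec :: "'f signat \<Rightarrow> ('f, 'a) alg \<Rightarrow> ('a \<times> 'a) set set" where
  "Spec \<sigma> M = {\<phi> \<in> Con \<sigma> M. \<phi> \<noteq> Nabla M \<and>
     (\<forall>\<alpha>\<in>Con \<sigma> M. \<forall>\<beta>\<in>Con \<sigma> M. commutator \<sigma> M \<alpha> \<beta> \<subseteq> \<phi> \<longrightarrow> \<alpha> \<subseteq> \<phi> \<or> \<beta> \<subseteq> \<phi>)}"

definition Vset :: "'f signat \<Rightarrow> ('f, 'a) alg \<Rightarrow> ('a \<times> 'a) set \<Rightarrow> ('a \<times> 'a) set set" where
  "Vset \<sigma> M \<theta> = {\<phi> \<in> Spec \<sigma> M. \<theta> \<subseteq> \<phi>}"

text \<open>See \<open>closedin_stone\<close> below.\<close>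

definition stone :: "'f signat \<Rightarrow> ('f, 'a) alg \<Rightarrow> ('a \<times> 'a) set topology" where
  "stone \<sigma> M = topology (\<lambda>U. \<exists>\<theta>\<in>Con \<sigma> M. U = Spec \<sigma> M - Vset \<sigma> M \<theta>)"


section \<open>Inverse images, admissibility, Going Up and Lying Over\<close>

definition inv_con :: "('f, 'a) alg \<Rightarrow> ('a \<Rightarrow> 'b) \<Rightarrow> ('b \<times> 'b) set \<Rightarrow> ('a \<times> 'a) set" where
  "inv_con A f \<psi> = {(x, y). x \<in> carr A \<and> y \<in> carr A \<and> (f x, f y) \<in> \<psi>}"

definition Ker :: "('f, 'a) alg \<Rightarrow> ('f, 'b) alg \<Rightarrow> ('a \<Rightarrow> 'b) \<Rightarrow> ('a \<times> 'a) set" where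
  "Ker A B f = inv_con A f (Delta B)"

definition admissible_mor :: "'f signat \<Rightarrow> ('f, 'a) alg \<Rightarrow> ('f, 'b) alg \<Rightarrow> ('a \<Rightarrow> 'b) \<Rightarrow> bool" where
  "admissible_mor \<sigma> A B f \<longleftrightarrow> (\<forall>\<psi>\<in>Spec \<sigma> B. inv_con A f \<psi> \<in> Spec \<sigma> A)"

definition GU :: "'f signat \<Rightarrow> ('f, 'a) alg \<Rightarrow> ('f, 'b) alg \<Rightarrow> ('a \<Rightarrow> 'b) \<Rightarrow> bool" where
  "GU \<sigma> A B f \<longleftrightarrow>
     (\<forall>\<phi>\<in>Spec \<sigma> A. \<forall>\<psi>\<in>Spec \<sigma> A. \<forall>\<phi>\<^sub>1\<in>Spec \<sigma> B. \<phi> \<subseteq> \<psi> \<and> inv_con A f \<phi>\<^sub>1 = \<phi> \<longrightarrow>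
        (\<exists>\<psi>\<^sub>1\<in>Spec \<sigma> B. \<phi>\<^sub>1 \<subseteq> \<psi>\<^sub>1 \<and> inv_con A f \<psi>\<^sub>1 = \<psi>))"

definition LO :: "'f signat \<Rightarrow> ('f, 'a) alg \<Rightarrow> ('f, 'b) alg \<Rightarrow> ('a \<Rightarrow> 'b) \<Rightarrow> bool" where
  "LO \<sigma> A B f \<longleftrightarrow>
     (\<forall>\<phi>\<in>Spec \<sigma> A. Ker A B f \<subseteq> \<phi> \<longrightarrow> (\<exists>\<phi>\<^sub>1\<in>Spec \<sigma> B. inv_con A f \<phi>\<^sub>1 = \<phi>))"

text \<open>
  The morphism \<open>f\<^sub>\<beta> : A/f\<^sup>*(\<beta>) \<rightarrow> B/\<beta>\<close>: the \<open>\<beta>\<close>-class containing the image of a given \<open>f\<^sup>*(\<beta>)\<close>-class;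
  see \<open>induced_class\<close> below for \<open>f\<^sub>\<beta>(a/f\<^sup>*(\<beta>)) = f(a)/\<beta>\<close>.
\<close>

definition induced :: "('a \<Rightarrow> 'b) \<Rightarrow> ('b \<times> 'b) set \<Rightarrow> 'a set \<Rightarrow> 'b set" where
  "induced f \<beta> X = \<beta> `` (f ` X)"

definition all_equivalent :: "bool list \<Rightarrow> bool" where
  "all_equivalent Ps \<longleftrightarrow> (\<forall>P\<in>set Ps. \<forall>Q\<in>set Ps. P \<longleftrightarrow> Q)"


section \<open>Adequacy of the definitions\<close>

lemma ConD:
  assumes "\<theta> \<in> Con \<sigma> M"
  shows "\<theta> \<subseteq> carr M \<times> carr M" "\<And>x. x \<in> carr M \<Longrightarrow> (x, x) \<in> \<theta>" "sym \<theta>" "trans \<theta>"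
    "\<And>f xs ys. \<sigma> f = Some (length xs) \<Longrightarrow> list_all2 (\<lambda>x y. (x, y) \<in> \<theta>) xs ys \<Longrightarrow>
        (oper M f xs, oper M f ys) \<in> \<theta>"
  using assms unfolding Con_def equiv_def refl_on_def by simp_all

lemma ConI:
  assumes "\<theta> \<subseteq> carr M \<times> carr M" "\<And>x. x \<in> carr M \<Longrightarrow> (x, x) \<in> \<theta>" "sym \<theta>" "trans \<theta>"
    "\<And>f xs ys. \<sigma> f = Some (length xs) \<Longrightarrow> list_all2 (\<lambda>x y. (x, y) \<in> \<theta>) xs ys \<Longrightarrow>
        (oper M f xs, oper M f ys) \<in> \<theta>"
  shows "\<theta> \<in> Con \<sigma> M"
  using assms unfolding Con_def equiv_def refl_on_def by simp

lemma list_all2_in: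
  assumes "R \<subseteq> S \<times> S" "list_all2 (\<lambda>x y. (x, y) \<in> R) xs ys"
  shows "set xs \<subseteq> S \<and> set ys \<subseteq> S \<and> length ys = length xs"
  using assms(2)
proof (induction xs ys rule: list_all2_induct)
  case (Cons x xs y ys)
  then have "x \<in> S" "y \<in> S" using assms(1) by blast+
  with Cons.IH show ?case by simp
qed simp

lemma Nabla_Con:
  assumes "is_alg \<sigma> M"
  shows "Nabla M \<in> Con \<sigma> M"
proof (rule ConI)
  fix f xs ys
  assume f: "\<sigma> f = Some (length xs)" and "list_all2 (\<lambda>x y. (x, y) \<in> Nabla M) xs ys"
  then have "set xs \<subseteq> carr M \<and> set ys \<subseteq> carr M \<and> length ys = length xs"
    by (intro list_all2_in[of "Nabla M"]) (simp_all add: Nabla_def)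
  then show "(oper M f xs, oper M f ys) \<in> Nabla M"
    using assms f by (simp add: is_alg_def Nabla_def)
qed (simp_all add: Nabla_def sym_def trans_def)

lemma Inter_Con:
  assumes "K \<noteq> {}" "K \<subseteq> Con \<sigma> M"
  shows "\<Inter>K \<in> Con \<sigma> M"
proof (rule ConI)
  have K: "\<theta> \<in> Con \<sigma> M" if "\<theta> \<in> K" for \<theta> using assms(2) that by blast
  obtain \<theta>\<^sub>0 where "\<theta>\<^sub>0 \<in> K" using assms(1) by blast
  then show "\<Inter>K \<subseteq> carr M \<times> carr M" using ConD(1)[OF K] by blast
  show "(x, x) \<in> \<Inter>K" if "x \<in> carr M" for x
    using ConD(2)[OF K that] by (rule InterI)
  show "sym (\<Inter>K)"
  proof (rule symI)
    fix x y assume *: "(x, y) \<in> \<Inter>K"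
    show "(y, x) \<in> \<Inter>K"
    proof
      fix \<theta> assume "\<theta> \<in> K"
      with * show "(y, x) \<in> \<theta>" using symD[OF ConD(3)[OF K]] by blast
    qed
  qed
  show "trans (\<Inter>K)"
  proof (rule transI)
    fix x y z assume *: "(x, y) \<in> \<Inter>K" "(y, z) \<in> \<Inter>K"
    show "(x, z) \<in> \<Inter>K"
    proof
      fix \<theta> assume "\<theta> \<in> K"
      with * show "(x, z) \<in> \<theta>" using transD[OF ConD(4)[OF K], of \<theta> x y z] by blast
    qed
  qed
  show "(oper M f xs, oper M f ys) \<in> \<Inter>K"
    if f: "\<sigma> f = Some (length xs)" and xy: "list_all2 (\<lambda>x y. (x, y) \<in> \<Inter>K) xs ys" for f xs ys
  proof
    fix \<theta> assume \<theta>: "\<theta> \<in> K"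
    have "list_all2 (\<lambda>x y. (x, y) \<in> \<theta>) xs ys"
      using xy by (rule list_all2_mono) (use \<theta> in blast)
    with f show "(oper M f xs, oper M f ys) \<in> \<theta>" by (rule ConD(5)[OF K[OF \<theta>]])
  qed
qed

lemma Int_Con: "\<alpha> \<in> Con \<sigma> M \<Longrightarrow> \<beta> \<in> Con \<sigma> M \<Longrightarrow> \<alpha> \<inter> \<beta> \<in> Con \<sigma> M"
  using Inter_Con[of "{\<alpha>, \<beta>}" \<sigma> M] by simp

lemma Cg_Con: "is_alg \<sigma> M \<Longrightarrow> S \<subseteq> carr M \<times> carr M \<Longrightarrow> Cg \<sigma> M S \<in> Con \<sigma> M"
  unfolding Cg_def using Nabla_Con[of \<sigma> M] by (intro Inter_Con) (auto simp: Nabla_def)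

lemma Cg_superset: "S \<subseteq> Cg \<sigma> M S"
  by (auto simp: Cg_def)

lemma Cg_least: "\<theta> \<in> Con \<sigma> M \<Longrightarrow> S \<subseteq> \<theta> \<Longrightarrow> Cg \<sigma> M S \<subseteq> \<theta>"
  by (auto simp: Cg_def)

lemma eval_Con:
  assumes "\<theta> \<in> Con \<sigma> M" "wf_trm \<sigma> t" "\<And>x. (v x, w x) \<in> \<theta>"
  shows "(eval_trm M v t, eval_trm M w t) \<in> \<theta>"
  using assms(2)
proof (induction t)
  case (Op f ts)
  then have "list_all2 (\<lambda>x y. (x, y) \<in> \<theta>) (map (eval_trm M v) ts) (map (eval_trm M w) ts)"
    by (auto simp: list_all2_map1 list_all2_map2 list_all2_same)
  then show ?case using ConD(5)[OF assms(1)] Op.prems by simp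
qed (simp add: assms(3))

lemma term_condition_Int:
  fixes \<sigma> :: "'f signat"
  assumes "\<alpha> \<in> Con \<sigma> M" "\<beta> \<in> Con \<sigma> M"
  shows "term_condition \<sigma> M \<alpha> \<beta> (\<alpha> \<inter> \<beta>)"
  unfolding term_condition_def
proof (intro allI impI, elim conjE)
  fix t :: "('f, nat + nat) trm" and a b c d
  assume wf: "wf_trm \<sigma> t" and ab: "\<forall>i. (a i, b i) \<in> \<alpha>" and cd: "\<forall>j. (c j, d j) \<in> \<beta>"
    and *: "(eval_trm M (case_sum a c) t, eval_trm M (case_sum a d) t) \<in> \<alpha> \<inter> \<beta>"
  note \<alpha> = ConD[OF assms(1)] and \<beta> = ConD[OF assms(2)]
  have carr: "a i \<in> carr M" "b i \<in> carr M" "c i \<in> carr M" "d i \<in> carr M" for i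
    using ab cd \<alpha>(1) \<beta>(1) by blast+
  have "(eval_trm M (case_sum a e) t, eval_trm M (case_sum b e) t) \<in> \<alpha>"
    if "\<And>j. e j \<in> carr M" for e
    by (rule eval_Con[OF assms(1) wf]) (use ab \<alpha>(2) that in \<open>auto split: sum.split\<close>)
  then have "(eval_trm M (case_sum b c) t, eval_trm M (case_sum b d) t) \<in> \<alpha>"
    using * carr \<alpha>(3,4) by (meson IntD1 symE transE)
  moreover have "(eval_trm M (case_sum b c) t, eval_trm M (case_sum b d) t) \<in> \<beta>"
    by (rule eval_Con[OF assms(2) wf]) (use cd carr \<beta>(2) in \<open>auto split: sum.split\<close>)
  ultimately show "(eval_trm M (case_sum b c) t, eval_trm M (case_sum b d) t) \<in> \<alpha> \<inter> \<beta>" by blast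
qed

lemma commutator_least:
  assumes "\<alpha> \<in> Con \<sigma> M" "\<beta> \<in> Con \<sigma> M"
  shows "commutator \<sigma> M \<alpha> \<beta> \<in> Con \<sigma> M"
    and "term_condition \<sigma> M \<alpha> \<beta> (commutator \<sigma> M \<alpha> \<beta>)"
    and "\<delta> \<in> Con \<sigma> M \<Longrightarrow> term_condition \<sigma> M \<alpha> \<beta> \<delta> \<Longrightarrow> commutator \<sigma> M \<alpha> \<beta> \<subseteq> \<delta>"
proof -
  show "\<delta> \<in> Con \<sigma> M \<Longrightarrow> term_condition \<sigma> M \<alpha> \<beta> \<delta> \<Longrightarrow> commutator \<sigma> M \<alpha> \<beta> \<subseteq> \<delta>"
    by (auto simp: commutator_def)
  show "term_condition \<sigma> M \<alpha> \<beta> (commutator \<sigma> M \<alpha> \<beta>)"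
    unfolding commutator_def term_condition_def by blast
  show "commutator \<sigma> M \<alpha> \<beta> \<in> Con \<sigma> M"
    unfolding commutator_def using Int_Con term_condition_Int assms by (intro Inter_Con) blast+
qed

lemma commutator_le_Int:
  "\<alpha> \<in> Con \<sigma> M \<Longrightarrow> \<beta> \<in> Con \<sigma> M \<Longrightarrow> commutator \<sigma> M \<alpha> \<beta> \<subseteq> \<alpha> \<inter> \<beta>"
  by (intro commutator_least(3) Int_Con term_condition_Int)

lemma istopology_stone:
  assumes M: "is_alg \<sigma> M"
  shows "istopology (\<lambda>U. \<exists>\<theta>\<in>Con \<sigma> M. U = Spec \<sigma> M - Vset \<sigma> M \<theta>)" (is "istopology ?L")
  unfolding istopology_def
proof (intro conjI allI impI)
  fix S T assume "?L S" "?L T"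
  then obtain \<theta> \<zeta> where tz: "\<theta> \<in> Con \<sigma> M" "\<zeta> \<in> Con \<sigma> M"
    "S = Spec \<sigma> M - Vset \<sigma> M \<theta>" "T = Spec \<sigma> M - Vset \<sigma> M \<zeta>" by blast
  have "Vset \<sigma> M \<theta> \<union> Vset \<sigma> M \<zeta> = Vset \<sigma> M (\<theta> \<inter> \<zeta>)"
  proof
    show "Vset \<sigma> M \<theta> \<union> Vset \<sigma> M \<zeta> \<subseteq> Vset \<sigma> M (\<theta> \<inter> \<zeta>)" by (auto simp: Vset_def)
    show "Vset \<sigma> M (\<theta> \<inter> \<zeta>) \<subseteq> Vset \<sigma> M \<theta> \<union> Vset \<sigma> M \<zeta>"
    proof
      fix \<phi> assume "\<phi> \<in> Vset \<sigma> M (\<theta> \<inter> \<zeta>)"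
      then have \<phi>: "\<phi> \<in> Spec \<sigma> M" "\<theta> \<inter> \<zeta> \<subseteq> \<phi>" unfolding Vset_def by blast+
      then have "commutator \<sigma> M \<theta> \<zeta> \<subseteq> \<phi>" using commutator_le_Int[OF tz(1,2)] by blast
      then have "\<theta> \<subseteq> \<phi> \<or> \<zeta> \<subseteq> \<phi>" using \<phi>(1) tz(1,2) unfolding Spec_def by blast
      then show "\<phi> \<in> Vset \<sigma> M \<theta> \<union> Vset \<sigma> M \<zeta>" using \<phi>(1) by (auto simp: Vset_def)
    qed
  qed
  then have "S \<inter> T = Spec \<sigma> M - Vset \<sigma> M (\<theta> \<inter> \<zeta>)" using tz(3,4) by blast
  then show "?L (S \<inter> T)" using Int_Con[OF tz(1,2)] by blast
next
  fix K assume K: "\<forall>S\<in>K. ?L S"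
  let ?H = "{\<theta> \<in> Con \<sigma> M. Spec \<sigma> M - Vset \<sigma> M \<theta> \<in> K}"
  let ?G = "Cg \<sigma> M (\<Union>?H)"
  have G: "?G \<in> Con \<sigma> M" using M by (intro Cg_Con) (use ConD(1) in blast)+
  have "\<Union>K = Spec \<sigma> M - Vset \<sigma> M ?G"
  proof (intro equalityI subsetI)
    fix \<phi> assume "\<phi> \<in> \<Union>K"
    then obtain S where S: "S \<in> K" "\<phi> \<in> S" by blast
    then obtain \<theta> where \<theta>: "\<theta> \<in> Con \<sigma> M" "S = Spec \<sigma> M - Vset \<sigma> M \<theta>" using K by blast
    then have "\<theta> \<subseteq> ?G" using S Cg_superset[of "\<Union>?H" \<sigma> M] by blast
    moreover have "\<phi> \<in> Spec \<sigma> M" "\<not> \<theta> \<subseteq> \<phi>" using S(2) \<theta>(2) by (auto simp: Vset_def)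
    ultimately show "\<phi> \<in> Spec \<sigma> M - Vset \<sigma> M ?G" unfolding Vset_def by blast
  next
    fix \<phi> assume \<phi>: "\<phi> \<in> Spec \<sigma> M - Vset \<sigma> M ?G"
    then have "\<phi> \<in> Con \<sigma> M" "\<not> ?G \<subseteq> \<phi>" unfolding Vset_def Spec_def by blast+
    then have "\<not> \<Union>?H \<subseteq> \<phi>" using Cg_least[of \<phi> \<sigma> M "\<Union>?H"] by blast
    then obtain \<theta> where \<theta>: "\<theta> \<in> ?H" "\<not> \<theta> \<subseteq> \<phi>" by blast
    then have "\<phi> \<in> Spec \<sigma> M - Vset \<sigma> M \<theta>" using \<phi> by (simp add: Vset_def)
    then show "\<phi> \<in> \<Union>K" using \<theta>(1) by blast
  qed
  then show "?L (\<Union>K)" using G by blast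
qed

lemma closedin_stone:
  assumes "is_alg \<sigma> M"
  shows "closedin (stone \<sigma> M) C \<longleftrightarrow> (\<exists>\<theta>\<in>Con \<sigma> M. C = Vset \<sigma> M \<theta>)"
    and "topspace (stone \<sigma> M) = Spec \<sigma> M"
proof -
  have o: "openin (stone \<sigma> M) U \<longleftrightarrow> (\<exists>\<theta>\<in>Con \<sigma> M. U = Spec \<sigma> M - Vset \<sigma> M \<theta>)" for U
    unfolding stone_def using istopology_stone[OF assms] by simp
  have "openin (stone \<sigma> M) (Spec \<sigma> M)"
    using Nabla_Con[OF assms] ConD(1)
    unfolding o by (intro bexI[of _ "Nabla M"]) (fastforce simp: Vset_def Spec_def Nabla_def)+
  then show t: "topspace (stone \<sigma> M) = Spec \<sigma> M"
    using o by (auto simp: topspace_def)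
  have "Vset \<sigma> M \<theta> \<subseteq> Spec \<sigma> M" for \<theta> by (auto simp: Vset_def)
  then show "closedin (stone \<sigma> M) C \<longleftrightarrow> (\<exists>\<theta>\<in>Con \<sigma> M. C = Vset \<sigma> M \<theta>)"
    unfolding closedin_def t o by blast
qed

lemma eval_in_carr:
  "is_alg \<sigma> M \<Longrightarrow> range v \<subseteq> carr M \<Longrightarrow> wf_trm \<sigma> t \<Longrightarrow> eval_trm M v t \<in> carr M"
proof (induction t)
  case (Op f ts)
  then have "set (map (eval_trm M v) ts) \<subseteq> carr M" by auto
  then show ?case using Op.prems by (simp add: is_alg_def)
qed auto

lemma eval_morphism:
  assumes "is_alg \<sigma> A" "morphism \<sigma> A B h" "range v \<subseteq> carr A"
  shows "wf_trm \<sigma> t \<Longrightarrow> h (eval_trm A v t) = eval_trm B (h \<circ> v) t"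
proof (induction t)
  case (Op f ts)
  have "set (map (eval_trm A v) ts) \<subseteq> carr A" using Op.prems eval_in_carr[OF assms(1,3)] by auto
  then have "h (oper A f (map (eval_trm A v) ts)) = oper B f (map h (map (eval_trm A v) ts))"
    using assms(2) Op.prems by (simp add: morphism_def)
  also have "map h (map (eval_trm A v) ts) = map (eval_trm B (h \<circ> v)) ts"
    unfolding map_map by (rule map_cong) (use Op in \<open>simp_all add: comp_def\<close>)
  finally show ?case by (simp add: comp_def)
qed simp

lemma inv_con_Con:
  assumes A: "is_alg \<sigma> A" and h: "morphism \<sigma> A B h" and \<psi>: "\<psi> \<in> Con \<sigma> B"
  shows "inv_con A h \<psi> \<in> Con \<sigma> A"
proof (rule ConI, goal_cases)
  case 1 then show ?case by (auto simp: inv_con_def)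
next
  case (2 x) then show ?case using h ConD(2)[OF \<psi>] by (auto simp: inv_con_def morphism_def)
next
  case 3 then show ?case using ConD(3)[OF \<psi>] by (auto simp: inv_con_def sym_def)
next
  case 4 then show ?case using ConD(4)[OF \<psi>] unfolding inv_con_def trans_def by blast
next
  case (5 f xs ys)
  have l: "set xs \<subseteq> carr A" "set ys \<subseteq> carr A" "length ys = length xs"
    using list_all2_in[OF _ 5(2), of "carr A"] by (auto simp: inv_con_def)
  have "list_all2 (\<lambda>x y. (x, y) \<in> \<psi>) (map h xs) (map h ys)"
    unfolding list_all2_map1 list_all2_map2
    using 5(2) by (rule list_all2_mono) (simp add: inv_con_def)
  then have "(oper B f (map h xs), oper B f (map h ys)) \<in> \<psi>"
    using ConD(5)[OF \<psi>] 5(1) by simp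
  then show ?case using A h l 5(1) by (simp add: inv_con_def morphism_def is_alg_def)
qed

lemma induced_class:
  assumes "morphism \<sigma> A B f" "\<beta> \<in> Con \<sigma> B" "a \<in> carr A"
  shows "induced f \<beta> (inv_con A f \<beta> `` {a}) = \<beta> `` {f a}"
proof -
  have "f a \<in> carr B" using assms(1,3) by (auto simp: morphism_def)
  then have "(a, a) \<in> inv_con A f \<beta>"
    using ConD(2)[OF assms(2)] assms(3) by (simp add: inv_con_def)
  moreover have "\<beta> `` {f x} = \<beta> `` {f a}" if "(a, x) \<in> inv_con A f \<beta>" for x
    using that equiv_class_eq[of "carr B" \<beta> "f a" "f x"] assms(2)
    by (simp add: inv_con_def Con_def)
  ultimately show ?thesis unfolding induced_def by blast
qed

lemma quot_oper:
  assumes M: "is_alg \<sigma> M" and \<theta>: "\<theta> \<in> Con \<sigma> M" and f: "\<sigma> f = Some (length xs)" "set xs \<subseteq> carr M"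
  shows "oper (quot_alg M \<theta>) f (map (\<lambda>x. \<theta> `` {x}) xs) = \<theta> `` {oper M f xs}"
proof -
  have "(x, SOME y. y \<in> \<theta> `` {x}) \<in> \<theta>" if "x \<in> carr M" for x
    using someI[of "\<lambda>y. y \<in> \<theta> `` {x}" x] ConD(2)[OF \<theta>] that by simp
  then have "list_all2 (\<lambda>x y. (x, y) \<in> \<theta>) xs (map ((\<lambda>X. SOME y. y \<in> X) \<circ> (\<lambda>x. \<theta> `` {x})) xs)"
    using f(2) by (auto simp: list_all2_map2 list_all2_same)
  then have "(oper M f xs, oper M f (map ((\<lambda>X. SOME y. y \<in> X) \<circ> (\<lambda>x. \<theta> `` {x})) xs)) \<in> \<theta>"
    using ConD(5)[OF \<theta>] f(1) by blast
  then show ?thesis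
    using equiv_class_eq[of "carr M" \<theta>] \<theta> unfolding quot_alg_def Con_def by (simp add: comp_def)
qed


subsection \<open>Congruence modularity does not depend on the carrier type\<close>

lemma trancl_Con:
  assumes M: "is_alg \<sigma> M" and \<beta>: "\<beta> \<in> Con \<sigma> M" and \<gamma>: "\<gamma> \<in> Con \<sigma> M"
  shows "(\<beta> \<union> \<gamma>)\<^sup>+ \<in> Con \<sigma> M"
proof -
  let ?R = "(\<beta> \<union> \<gamma>)\<^sup>+"
  have sub: "?R \<subseteq> carr M \<times> carr M"
    by (rule trancl_subset_Sigma) (use ConD(1)[OF \<beta>] ConD(1)[OF \<gamma>] in blast)
  have refl: "(x, x) \<in> ?R" if "x \<in> carr M" for x
    using ConD(2)[OF \<beta> that] by blast
  have tr: "(x, z) \<in> ?R" if "(x, y) \<in> ?R" "(y, z) \<in> ?R" for x y z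
    using that by (rule trancl_trans)
  have coord1: "(oper M f (ps @ a # qs), oper M f (ps @ b # qs)) \<in> \<theta>"
    if "\<theta> \<in> Con \<sigma> M" "(a, b) \<in> \<theta>" "\<sigma> f = Some (Suc (length ps + length qs))"
      "set ps \<subseteq> carr M" "set qs \<subseteq> carr M" for f ps qs a b \<theta>
  proof (rule ConD(5)[OF that(1)])
    have "list_all2 (\<lambda>x y. (x, y) \<in> \<theta>) zs zs" if "set zs \<subseteq> carr M" for zs
      using that ConD(2)[OF \<open>\<theta> \<in> Con \<sigma> M\<close>] by (auto simp: list_all2_same)
    then show "list_all2 (\<lambda>x y. (x, y) \<in> \<theta>) (ps @ a # qs) (ps @ b # qs)"
      using that by (intro list_all2_appendI) auto
  qed (use that in simp)
  have coord: "(oper M f (ps @ a # qs), oper M f (ps @ b # qs)) \<in> ?R"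
    if "(a, b) \<in> ?R" "\<sigma> f = Some (Suc (length ps + length qs))"
      "set ps \<subseteq> carr M" "set qs \<subseteq> carr M" for f ps qs a b
    using that(1)
  proof (induction rule: trancl_induct)
    case (base y)
    then show ?case using coord1[OF \<beta> _ that(2-4)] coord1[OF \<gamma> _ that(2-4)] by blast
  next
    case (step y z)
    then have "(oper M f (ps @ y # qs), oper M f (ps @ z # qs)) \<in> ?R"
      using coord1[OF \<beta> _ that(2-4)] coord1[OF \<gamma> _ that(2-4)] by blast
    with step.IH show ?case by (rule tr)
  qed
  have all: "(oper M f (ps @ xs), oper M f (ps @ ys)) \<in> ?R"
    if "list_all2 (\<lambda>x y. (x, y) \<in> ?R) xs ys" "\<sigma> f = Some (length ps + length xs)"
      "set ps \<subseteq> carr M" for f ps xs ys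
    using that
  proof (induction xs ys arbitrary: ps rule: list_all2_induct)
    case Nil
    then show ?case using M by (auto simp: is_alg_def intro!: refl)
  next
    case (Cons x xs y ys)
    have c: "x \<in> carr M" "y \<in> carr M" "set xs \<subseteq> carr M"
      using sub Cons.hyps list_all2_in[OF sub Cons.hyps(2)] by auto
    have "(oper M f (ps @ x # xs), oper M f (ps @ y # xs)) \<in> ?R"
      using coord[of x y f ps xs] Cons.hyps Cons.prems c by simp
    moreover have "(oper M f ((ps @ [y]) @ xs), oper M f ((ps @ [y]) @ ys)) \<in> ?R"
      using Cons.IH[of "ps @ [y]"] Cons.prems c by simp
    ultimately show ?case using tr by simp
  qed
  show ?thesis
  proof (rule ConI[OF sub refl])
    show "sym ?R" using ConD(3)[OF \<beta>] ConD(3)[OF \<gamma>] by (intro sym_trancl sym_Un)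
    show "trans ?R" by (rule trans_trancl)
    show "(oper M f xs, oper M f ys) \<in> ?R"
      if "\<sigma> f = Some (length xs)" "list_all2 (\<lambda>x y. (x, y) \<in> ?R) xs ys" for f xs ys
      using all[of xs ys f "[]"] that by simp
  qed
qed

lemma trancl_finite_support:
  assumes "(x, y) \<in> R\<^sup>+"
  shows "\<exists>Z. finite Z \<and> Z \<subseteq> Field R \<and> (x, y) \<in> (R \<inter> Z \<times> Z)\<^sup>+"
  using assms
proof (induction rule: trancl_induct)
  case (base y)
  then have "(x, y) \<in> (R \<inter> {x, y} \<times> {x, y})\<^sup>+" by (intro r_into_trancl) simp
  moreover have "{x, y} \<subseteq> Field R" using base by (auto simp: Field_def)
  ultimately show ?case by (intro exI[of _ "{x, y}"]) simp
next
  case (step y z)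
  then obtain Z where Z: "finite Z" "Z \<subseteq> Field R" "(x, y) \<in> (R \<inter> Z \<times> Z)\<^sup>+" by blast
  let ?Z = "Z \<union> {y, z}"
  have "(x, y) \<in> (R \<inter> ?Z \<times> ?Z)\<^sup>+" by (rule trancl_mono[OF Z(3)]) blast
  moreover have "(y, z) \<in> R \<inter> ?Z \<times> ?Z" using step by blast
  ultimately have "(x, z) \<in> (R \<inter> ?Z \<times> ?Z)\<^sup>+" by (rule trancl_into_trancl)
  moreover have "?Z \<subseteq> Field R" using Z step by (auto simp: Field_def)
  moreover have "finite ?Z" using Z(1) by simp
  ultimately show ?case by blast
qed

text \<open>A countably generated subalgebra has an isomorphic copy on representing terms.\<close>

lemma countably_generated_copy:
  fixes M :: "('f, 'a) alg" and e :: "nat \<Rightarrow> 'a"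
  assumes M: "in_class \<sigma> E M" and E: "wf_identities \<sigma> E" and e: "range e \<subseteq> carr M"
  obtains N :: "('f, ('f, nat) trm) alg" and h where
    "in_class \<sigma> E N" "morphism \<sigma> N M h" "inj_on h (carr N)" "range e \<subseteq> h ` carr N"
proof -
  have algM: "is_alg \<sigma> M" using M by (simp add: in_class_def)
  define h where "h = eval_trm M e"
  define S where "S = {h t | t. wf_trm \<sigma> t}"
  define rep where "rep x = (SOME t. wf_trm \<sigma> t \<and> h t = x)" for x
  define N where "N = \<lparr>carr = rep ` S, oper = (\<lambda>f ts. rep (oper M f (map h ts)))\<rparr>"
  have rep: "wf_trm \<sigma> (rep x) \<and> h (rep x) = x" if "x \<in> S" for x
  proof -
    have "\<exists>t. wf_trm \<sigma> t \<and> h t = x" using that by (auto simp: S_def)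
    then show ?thesis unfolding rep_def by (rule someI_ex)
  qed
  have wfN: "wf_trm \<sigma> t" "rep (h t) = t" if "t \<in> carr N" for t
    using that rep by (auto simp: N_def)
  have cl: "oper M f (map h ts) \<in> S" if "\<sigma> f = Some (length ts)" "set ts \<subseteq> carr N" for f ts
  proof -
    have "wf_trm \<sigma> (Op f ts)" using that wfN by auto
    moreover have "oper M f (map h ts) = h (Op f ts)" by (simp add: h_def)
    ultimately show ?thesis unfolding S_def by blast
  qed
  have e_S: "e n \<in> S" for n
    unfolding S_def h_def by (intro CollectI exI[of _ "Var n"]) simp
  have alg: "is_alg \<sigma> N"
    unfolding is_alg_def using e_S cl by (auto simp: N_def)
  have mor: "morphism \<sigma> N M h"
    unfolding morphism_def
  proof (intro conjI allI impI)
    show "h ` carr N \<subseteq> carr M" using wfN eval_in_carr[OF algM e] by (auto simp: h_def)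
    show "h (oper N f xs) = oper M f (map h xs)"
      if "\<sigma> f = Some (length xs) \<and> set xs \<subseteq> carr N" for f xs
      using rep cl that by (simp add: N_def)
  qed
  have inj: "inj_on h (carr N)" by (rule inj_on_inverseI[of _ rep]) (rule wfN(2))
  have "in_class \<sigma> E N"
    unfolding in_class_def
  proof (intro conjI alg ballI, clarify)
    fix s t and v :: "nat \<Rightarrow> ('f, nat) trm"
    assume st: "(s, t) \<in> E" and v: "range v \<subseteq> carr N"
    have wf: "wf_trm \<sigma> s" "wf_trm \<sigma> t" using E st by (auto simp: wf_identities_def)
    have "range (h \<circ> v) \<subseteq> carr M" using v mor by (auto simp: morphism_def)
    then have "eval_trm M (h \<circ> v) s = eval_trm M (h \<circ> v) t"
      using M st unfolding in_class_def by blast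
    then have "h (eval_trm N v s) = h (eval_trm N v t)"
      using eval_morphism[OF alg mor v] wf by simp
    then show "eval_trm N v s = eval_trm N v t"
      using inj_onD[OF inj] eval_in_carr[OF alg v] wf by blast
  qed
  then show ?thesis
  proof (rule that[OF _ mor inj])
    show "range e \<subseteq> h ` carr N"
    proof clarify
      fix n
      have "e n = h (rep (e n))" "rep (e n) \<in> carr N" using e_S rep by (simp_all add: N_def)
      then show "e n \<in> h ` carr N" by (rule image_eqI)
    qed
  qed
qed

theorem congruence_modular_all:
  fixes M :: "('f, 'a) alg"
  assumes cm: "congruence_modular \<sigma> E" and E: "wf_identities \<sigma> E" and M: "in_class \<sigma> E M"
  shows "con_modular \<sigma> M"
  unfolding con_modular_def
proof (intro ballI impI equalityI)
  fix \<alpha> \<beta> \<gamma> assume \<alpha>: "\<alpha> \<in> Con \<sigma> M" and \<beta>: "\<beta> \<in> Con \<sigma> M" and \<gamma>: "\<gamma> \<in> Con \<sigma> M" and "\<gamma> \<subseteq> \<alpha>"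
  have alg: "is_alg \<sigma> M" using M by (simp add: in_class_def)
  have bg: "Cg \<sigma> M (\<beta> \<union> \<gamma>) \<in> Con \<sigma> M"
    using ConD(1)[OF \<beta>] ConD(1)[OF \<gamma>] by (intro Cg_Con alg) auto
  show "Cg \<sigma> M ((\<alpha> \<inter> \<beta>) \<union> \<gamma>) \<subseteq> \<alpha> \<inter> Cg \<sigma> M (\<beta> \<union> \<gamma>)"
    using \<open>\<gamma> \<subseteq> \<alpha>\<close> Cg_superset[of "\<beta> \<union> \<gamma>" \<sigma> M] by (intro Cg_least Int_Con \<alpha> bg) auto
  show "\<alpha> \<inter> Cg \<sigma> M (\<beta> \<union> \<gamma>) \<subseteq> Cg \<sigma> M ((\<alpha> \<inter> \<beta>) \<union> \<gamma>)"
  proof (rule subrelI)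
    fix x y assume xy: "(x, y) \<in> \<alpha> \<inter> Cg \<sigma> M (\<beta> \<union> \<gamma>)"
    have "Cg \<sigma> M (\<beta> \<union> \<gamma>) \<subseteq> (\<beta> \<union> \<gamma>)\<^sup>+"
      by (intro Cg_least trancl_Con alg \<beta> \<gamma>) auto
    then have "(x, y) \<in> (\<beta> \<union> \<gamma>)\<^sup>+" using xy by blast
    then obtain Z where Z: "finite Z" "Z \<subseteq> Field (\<beta> \<union> \<gamma>)" "(x, y) \<in> ((\<beta> \<union> \<gamma>) \<inter> Z \<times> Z)\<^sup>+"
      using trancl_finite_support by metis
    have Zcarr: "Z \<subseteq> carr M"
      using Z(2) ConD(1)[OF \<beta>] ConD(1)[OF \<gamma>] by (fastforce simp: Field_def)
    have xyZ: "x \<in> Z" "y \<in> Z"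
      using trancl_subset_Sigma[of "(\<beta> \<union> \<gamma>) \<inter> Z \<times> Z" Z] Z(3) by auto
    obtain n and g :: "nat \<Rightarrow> 'a" where g: "Z = g ` {i. i < n}"
      using finite_imp_nat_seg_image_inj_on[OF Z(1)] by blast
    define e where "e i = (if i < n then g i else x)" for i
    have e: "range e = Z" using g xyZ(1) by (auto simp: e_def)
    obtain N :: "('f, ('f, nat) trm) alg" and h where N: "in_class \<sigma> E N" "morphism \<sigma> N M h"
      "inj_on h (carr N)" "range e \<subseteq> h ` carr N"
      using countably_generated_copy[OF M E] e Zcarr by metis
    have algN: "is_alg \<sigma> N" using N(1) by (simp add: in_class_def)
    have inv: "inv_con N h \<theta> \<in> Con \<sigma> N" if "\<theta> \<in> Con \<sigma> M" for \<theta>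
      by (rule inv_con_Con[OF algN N(2) that])
    define r where "r = inv_into (carr N) h"
    have r: "r z \<in> carr N" "h (r z) = z" if "z \<in> Z" for z
      using that N(4) e by (auto simp: r_def inv_into_into f_inv_into_f)
    let ?\<alpha> = "inv_con N h \<alpha>" and ?\<beta> = "inv_con N h \<beta>" and ?\<gamma> = "inv_con N h \<gamma>"
    have bgN: "Cg \<sigma> N (?\<beta> \<union> ?\<gamma>) \<in> Con \<sigma> N"
      by (intro Cg_Con algN) (auto simp: inv_con_def)
    have step: "(r u, r v) \<in> Cg \<sigma> N (?\<beta> \<union> ?\<gamma>)" if "(u, v) \<in> (\<beta> \<union> \<gamma>) \<inter> Z \<times> Z" for u v
      using that r Cg_superset[of "?\<beta> \<union> ?\<gamma>" \<sigma> N] by (auto simp: inv_con_def)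
    have "(r x, r y) \<in> Cg \<sigma> N (?\<beta> \<union> ?\<gamma>)"
      using Z(3)
    proof (induction rule: trancl_induct)
      case (base y) then show ?case by (rule step)
    next
      case (step y z)
      then show ?case using \<open>\<And>v u. (u, v) \<in> (\<beta> \<union> \<gamma>) \<inter> Z \<times> Z \<Longrightarrow> (r u, r v) \<in> Cg \<sigma> N (?\<beta> \<union> ?\<gamma>)\<close>
        ConD(4)[OF bgN] by (meson transE)
    qed
    moreover have "(r x, r y) \<in> ?\<alpha>" using xy xyZ r by (auto simp: inv_con_def)
    moreover have "?\<gamma> \<subseteq> ?\<alpha>" using \<open>\<gamma> \<subseteq> \<alpha>\<close> by (auto simp: inv_con_def)
    moreover have "con_modular \<sigma> N" using cm N(1) by (simp add: congruence_modular_def)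
    ultimately have *: "(r x, r y) \<in> Cg \<sigma> N ((?\<alpha> \<inter> ?\<beta>) \<union> ?\<gamma>)"
      using inv[OF \<alpha>] inv[OF \<beta>] inv[OF \<gamma>] unfolding con_modular_def by blast
    have "Cg \<sigma> M ((\<alpha> \<inter> \<beta>) \<union> \<gamma>) \<in> Con \<sigma> M"
      using ConD(1)[OF \<alpha>] ConD(1)[OF \<gamma>] by (intro Cg_Con alg) auto
    then have "Cg \<sigma> N ((?\<alpha> \<inter> ?\<beta>) \<union> ?\<gamma>) \<subseteq> inv_con N h (Cg \<sigma> M ((\<alpha> \<inter> \<beta>) \<union> \<gamma>))"
      using Cg_superset[of "(\<alpha> \<inter> \<beta>) \<union> \<gamma>" \<sigma> M] by (intro Cg_least inv) (auto simp: inv_con_def)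
    then show "(x, y) \<in> Cg \<sigma> M ((\<alpha> \<inter> \<beta>) \<union> \<gamma>)"
      using * r xyZ by (auto simp: inv_con_def)
  qed
qed

end

theory Submission
  imports Defs
begin

text \<open>
  The commutator is studied through the congruence \<open>\<Delta>\<close> on the algebra \<open>\<beta> \<le> M\<^sup>2\<close> generated by the
  pairs \<open>((a, a), (b, b))\<close> with \<open>(a, b) \<in> \<alpha>\<close>: the term condition for \<open>\<alpha>, \<beta>\<close> modulo \<open>\<delta>\<close> says
  that \<open>\<delta>\<close> is saturated under \<open>\<Delta>\<close>. Modularity of \<open>Con(\<beta>)\<close> and \<open>Con(\<Delta>)\<close> makes the term condition
  equivalent to \<open>[\<alpha>, \<beta>] \<subseteq> \<delta>\<close> and symmetric, so \<open>[\<alpha>, \<beta>] \<subseteq> \<delta>\<close> implies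
  \<open>[\<alpha> \<or> \<delta>, \<beta> \<or> \<delta>] \<subseteq> \<delta>\<close>. Hence primality of \<open>\<phi>\<close> can be tested above \<open>\<phi>\<close>, and the primes of \<open>M/\<theta>\<close>
  are those of \<open>M\<close> containing \<open>\<theta>\<close>. Every condition then compares \<open>V(f\<^sup>*(\<beta>))\<close> with \<open>f\<^sup>*(V(\<beta>))\<close>.
  Going Up gives their equality for arbitrary \<open>\<beta>\<close>, because Zorn's lemma yields a prime
  \<open>\<gamma> \<supseteq> \<beta>\<close> with \<open>f\<^sup>*(\<gamma>) \<subseteq> \<phi>\<close> whenever \<open>f\<^sup>*(\<beta>) \<subseteq> \<phi>\<close>.
\<close>

section \<open>Subalgebras of squares\<close>

text \<open>The carrier is the relation itself, so a congruence becomes a subalgebra of the square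
  of \<open>M\<close>. Applying the construction again, to \<open>diag_con\<close>, yields an
  algebra of 2 x 2 matrices.\<close>

definition square :: "('f, 'a) alg \<Rightarrow> ('a \<times> 'a) set \<Rightarrow> ('f, 'a \<times> 'a) alg" where
  "square M \<theta> = \<lparr>carr = \<theta>, oper = (\<lambda>f ps. (oper M f (map fst ps), oper M f (map snd ps)))\<rparr>"

lemma carr_square [simp]: "carr (square M \<theta>) = \<theta>"
  by (simp add: square_def)

lemma oper_square: "oper (square M \<theta>) f ps = (oper M f (map fst ps), oper M f (map snd ps))"
  by (simp add: square_def)

lemma eval_square: "eval_trm (square M \<theta>) v t = (eval_trm M (fst \<circ> v) t, eval_trm M (snd \<circ> v) t)"
proof (induction t)
  case (Op f ts)
  then show ?case by (simp add: oper_square comp_def cong: map_cong)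
qed simp

lemma is_alg_square:
  assumes "is_alg \<sigma> M" "\<theta> \<in> Con \<sigma> M"
  shows "is_alg \<sigma> (square M \<theta>)"
  unfolding is_alg_def
proof (intro conjI allI impI)
  show "carr (square M \<theta>) \<noteq> {}" using assms ConD(2)[OF assms(2)] by (auto simp: is_alg_def)
  fix f xs assume f: "\<sigma> f = Some (length xs) \<and> set xs \<subseteq> carr (square M \<theta>)"
  then have "list_all2 (\<lambda>x y. (x, y) \<in> \<theta>) (map fst xs) (map snd xs)"
    by (auto simp: list_all2_map1 list_all2_map2 list_all2_same)
  then show "oper (square M \<theta>) f xs \<in> carr (square M \<theta>)"
    using ConD(5)[OF assms(2)] f by (simp add: oper_square)
qed

lemma morphism_square:
  assumes "\<theta> \<in> Con \<sigma> M"
  shows "morphism \<sigma> (square M \<theta>) M fst" "morphism \<sigma> (square M \<theta>) M snd"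
  using ConD(1)[OF assms] by (auto simp: morphism_def oper_square)

lemma in_class_square:
  assumes "in_class \<sigma> E M" "\<theta> \<in> Con \<sigma> M"
  shows "in_class \<sigma> E (square M \<theta>)"
proof -
  have "eval_trm (square M \<theta>) v s = eval_trm (square M \<theta>) v t"
    if "(s, t) \<in> E" and v: "range v \<subseteq> \<theta>" for s t and v :: "nat \<Rightarrow> 'b \<times> 'b"
  proof -
    have "range (fst \<circ> v) \<subseteq> carr M" "range (snd \<circ> v) \<subseteq> carr M"
      using v ConD(1)[OF assms(2)] by fastforce+
    then show ?thesis
      using assms(1) that(1) unfolding in_class_def eval_square by blast
  qed
  moreover have "is_alg \<sigma> (square M \<theta>)"
    using assms by (intro is_alg_square) (simp_all add: in_class_def)
  ultimately show ?thesis by (auto simp: in_class_def)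
qed

lemma Delta_Con:
  assumes "is_alg \<sigma> M"
  shows "Delta M \<in> Con \<sigma> M"
proof (rule ConI)
  fix f xs ys
  assume f: "\<sigma> f = Some (length xs)" and l: "list_all2 (\<lambda>x y. (x, y) \<in> Delta M) xs ys"
  have "list_all2 (=) xs ys" by (rule list_all2_mono[OF l]) (auto simp: Delta_def)
  then have "xs = ys" by (simp add: list.rel_eq)
  moreover have "set xs \<subseteq> carr M" using list_all2_in[OF _ l, of "carr M"] by (auto simp: Delta_def)
  ultimately show "(oper M f xs, oper M f ys) \<in> Delta M"
    using assms f by (auto simp: Delta_def is_alg_def)
qed (auto simp: Delta_def sym_def trans_def)

lemma trancl_compatible_Con:
  assumes sub: "T \<subseteq> carr M \<times> carr M" and refl: "\<And>x. x \<in> carr M \<Longrightarrow> (x, x) \<in> T" and "sym T"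
    and compat: "\<And>f xs ys. \<sigma> f = Some (length xs) \<Longrightarrow> list_all2 (\<lambda>x y. (x, y) \<in> T) xs ys \<Longrightarrow>
        (oper M f xs, oper M f ys) \<in> T"
  shows "T\<^sup>+ \<in> Con \<sigma> M"
proof (rule ConI)
  show sub': "T\<^sup>+ \<subseteq> carr M \<times> carr M" using sub by (rule trancl_subset_Sigma)
  show "(x, x) \<in> T\<^sup>+" if "x \<in> carr M" for x using refl[OF that] by blast
  show "sym (T\<^sup>+)" using \<open>sym T\<close> by (rule sym_trancl)
  show "trans (T\<^sup>+)" by (rule trans_trancl)
  have same: "list_all2 (\<lambda>x y. (x, y) \<in> T) zs zs" if "set zs \<subseteq> carr M" for zs
    using that refl by (auto simp: list_all2_same)
  have coord1: "(oper M f (ps @ a # qs), oper M f (ps @ b # qs)) \<in> T"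
    if "(a, b) \<in> T" "\<sigma> f = Some (length ps + Suc (length qs))"
      "set ps \<subseteq> carr M" "set qs \<subseteq> carr M" for f ps qs a b
    by (rule compat) (use that same in \<open>auto intro!: list_all2_appendI\<close>)
  have coord: "(oper M f (ps @ a # qs), oper M f (ps @ b # qs)) \<in> T\<^sup>+"
    if "(a, b) \<in> T\<^sup>+" "\<sigma> f = Some (length ps + Suc (length qs))"
      "set ps \<subseteq> carr M" "set qs \<subseteq> carr M" for f ps qs a b
    using that(1)
  proof (induction rule: trancl_induct)
    case (base y)
    then show ?case using coord1[OF _ that(2-4)] by blast
  next
    case (step y z)
    then show ?case using coord1[OF _ that(2-4), of y z] by (meson trancl.trancl_into_trancl)
  qed
  \<comment> \<open>The prefix \<open>ps\<close> collects the arguments already replaced; it is kept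
    arbitrary so that the induction step can append \<open>y\<close> to it.\<close>
  have all: "(oper M f (ps @ xs), oper M f (ps @ ys)) \<in> T\<^sup>+"
    if "list_all2 (\<lambda>x y. (x, y) \<in> T\<^sup>+) xs ys" "\<sigma> f = Some (length ps + length xs)"
      "set ps \<subseteq> carr M" for f ps xs ys
    using that
  proof (induction xs ys arbitrary: ps rule: list_all2_induct)
    case Nil
    then show ?case using same[of ps] compat[of f ps ps] by (auto intro: r_into_trancl)
  next
    case (Cons x xs y ys)
    have c: "x \<in> carr M" "y \<in> carr M" "set xs \<subseteq> carr M"
      using sub' Cons.hyps list_all2_in[OF sub' Cons.hyps(2)] by auto
    have "(oper M f (ps @ x # xs), oper M f (ps @ y # xs)) \<in> T\<^sup>+"
      using coord[of x y f ps xs] Cons.hyps Cons.prems c by simp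
    moreover have "(oper M f ((ps @ [y]) @ xs), oper M f ((ps @ [y]) @ ys)) \<in> T\<^sup>+"
      using Cons.IH[of "ps @ [y]"] Cons.prems c by simp
    ultimately show ?case by (simp add: trancl_trans)
  qed
  show "(oper M f xs, oper M f ys) \<in> T\<^sup>+"
    if "\<sigma> f = Some (length xs)" "list_all2 (\<lambda>x y. (x, y) \<in> T\<^sup>+) xs ys" for f xs ys
    using all[of xs ys f "[]"] that by simp
qed


section \<open>The term condition as saturation\<close>

text \<open>An element \<open>((p, q), (r, s))\<close> is read as the 2 x 2 matrix with rows
  \<open>(p, q)\<close> and \<open>(r, s)\<close>; the generators are the matrices with constant
  rows and both columns in \<open>\<alpha>\<close>.\<close>

definition diag_con ::
  "'f signat \<Rightarrow> ('f, 'a) alg \<Rightarrow> ('a \<times> 'a) set \<Rightarrow> ('a \<times> 'a) set \<Rightarrow> (('a \<times> 'a) \<times> ('a \<times> 'a)) set" where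
  "diag_con \<sigma> M \<alpha> \<beta> = Cg \<sigma> (square M \<beta>) {((a, a), (b, b)) | a b. (a, b) \<in> \<alpha>}"

lemma diag_con_Con:
  assumes "is_alg \<sigma> M" "\<alpha> \<in> Con \<sigma> M" "\<beta> \<in> Con \<sigma> M"
  shows "diag_con \<sigma> M \<alpha> \<beta> \<in> Con \<sigma> (square M \<beta>)"
  unfolding diag_con_def
  by (intro Cg_Con is_alg_square assms) (use ConD(1)[OF assms(2)] ConD(2)[OF assms(3)] in auto)

lemma diag_con_diag: "(a, b) \<in> \<alpha> \<Longrightarrow> ((a, a), (b, b)) \<in> diag_con \<sigma> M \<alpha> \<beta>"
  unfolding diag_con_def by (rule subsetD[OF Cg_superset]) blast

lemma diag_con_least:
  assumes "\<Theta> \<in> Con \<sigma> (square M \<beta>)" "\<And>a b. (a, b) \<in> \<alpha> \<Longrightarrow> ((a, a), (b, b)) \<in> \<Theta>"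
  shows "diag_con \<sigma> M \<alpha> \<beta> \<subseteq> \<Theta>"
  unfolding diag_con_def using assms by (intro Cg_least) auto

text \<open>Rows belong to the carrier of \<open>square M \<beta>\<close>. For the columns, the
  pullbacks of \<open>\<alpha>\<close> along the two projections are congruences containing the
  generators.\<close>

lemma diag_con_columns:
  assumes "is_alg \<sigma> M" "\<alpha> \<in> Con \<sigma> M" "\<beta> \<in> Con \<sigma> M" "((p, q), (r, s)) \<in> diag_con \<sigma> M \<alpha> \<beta>"
  shows "(p, q) \<in> \<beta>" "(r, s) \<in> \<beta>" "(p, r) \<in> \<alpha>" "(q, s) \<in> \<alpha>"
proof -
  have "inv_con (square M \<beta>) fst \<alpha> \<in> Con \<sigma> (square M \<beta>)"
    "inv_con (square M \<beta>) snd \<alpha> \<in> Con \<sigma> (square M \<beta>)"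
    using inv_con_Con[OF is_alg_square[OF assms(1,3)] _ assms(2)] morphism_square[OF assms(3)]
    by blast+
  then have "diag_con \<sigma> M \<alpha> \<beta> \<subseteq> inv_con (square M \<beta>) fst \<alpha> \<inter> inv_con (square M \<beta>) snd \<alpha>"
    by (intro diag_con_least Int_Con)
      (use ConD(1)[OF assms(2)] ConD(2)[OF assms(3)] in \<open>auto simp: inv_con_def\<close>)
  then show "(p, q) \<in> \<beta>" "(r, s) \<in> \<beta>" "(p, r) \<in> \<alpha>" "(q, s) \<in> \<alpha>"
    using assms(4) by (auto simp: inv_con_def)
qed

text \<open>Evaluate \<open>t\<close> in \<open>square M \<beta>\<close> with constant pairs for the
  left variables and \<open>(c j, d j)\<close> for the right ones: passing from \<open>a\<close> to
  \<open>b\<close> moves the inputs only within \<open>diag_con\<close>, and evaluation respects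
  congruences.\<close>

lemma eval_diag_con:
  assumes "is_alg \<sigma> M" "\<alpha> \<in> Con \<sigma> M" "\<beta> \<in> Con \<sigma> M" "wf_trm \<sigma> t"
    and "\<And>i. (a i, b i) \<in> \<alpha>" "\<And>j. (c j, d j) \<in> \<beta>"
  shows "((eval_trm M (case_sum a c) t, eval_trm M (case_sum a d) t),
          (eval_trm M (case_sum b c) t, eval_trm M (case_sum b d) t)) \<in> diag_con \<sigma> M \<alpha> \<beta>"
proof -
  let ?v = "case_sum (\<lambda>i. (a i, a i)) (\<lambda>j. (c j, d j))"
  let ?w = "case_sum (\<lambda>i. (b i, b i)) (\<lambda>j. (c j, d j))"
  have "(?v x, ?w x) \<in> diag_con \<sigma> M \<alpha> \<beta>" for x
    using ConD(2)[OF diag_con_Con[OF assms(1-3)]] assms(5,6)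
    by (auto split: sum.split intro: diag_con_diag)
  then have "(eval_trm (square M \<beta>) ?v t, eval_trm (square M \<beta>) ?w t) \<in> diag_con \<sigma> M \<alpha> \<beta>"
    by (rule eval_Con[OF diag_con_Con[OF assms(1-3)] assms(4)])
  moreover have "fst \<circ> ?v = case_sum a c" "snd \<circ> ?v = case_sum a d"
    "fst \<circ> ?w = case_sum b c" "snd \<circ> ?w = case_sum b d"
    by (auto split: sum.split)
  ultimately show ?thesis by (simp add: eval_square)
qed

lemma term_condition_of_saturated:
  assumes "is_alg \<sigma> M" "\<alpha> \<in> Con \<sigma> M" "\<beta> \<in> Con \<sigma> M"
    and "\<And>u v. (u, v) \<in> diag_con \<sigma> M \<alpha> \<beta> \<Longrightarrow> u \<in> \<delta> \<Longrightarrow> v \<in> \<delta>"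
  shows "term_condition \<sigma> M \<alpha> \<beta> \<delta>"
  unfolding term_condition_def using assms(4) eval_diag_con[OF assms(1-3)] by blast

section \<open>Terms whose variables are pairs, and the matrices they produce\<close>

lemma eval_cong: "(\<And>x. x \<in> set2_trm t \<Longrightarrow> v x = w x) \<Longrightarrow> eval_trm M v t = eval_trm M w t"
proof (induction t)
  case (Op f ts)
  then have "map (eval_trm M v) ts = map (eval_trm M w) ts" by auto
  then show ?case by (simp only: eval_trm.simps)
qed simp

lemma eval_map_trm: "eval_trm M v (map_trm id g t) = eval_trm M (v \<circ> g) t"
proof (induction t)
  case (Op f ts)
  then show ?case by (simp add: comp_def id_def cong: map_cong)
qed simp

lemma wf_map_trm: "wf_trm \<sigma> (map_trm id g t) = wf_trm \<sigma> t"
  by (induction t) auto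

lemma finite_vars: "finite (set2_trm t)"
  by (induction t) auto

text \<open>Indexing the variables by the pairs to be substituted for them avoids any renaming when the
  matrices of several terms are combined; \<open>fst\<close> and \<open>snd\<close> then serve as the tuples.\<close>

lemma term_condition_pairs:
  fixes t :: "('f, ('a \<times> 'a) + ('a \<times> 'a)) trm"
  assumes M: "is_alg \<sigma> M" and \<alpha>: "\<alpha> \<in> Con \<sigma> M" and \<beta>: "\<beta> \<in> Con \<sigma> M"
    and tc: "term_condition \<sigma> M \<alpha> \<beta> \<delta>"
    and t: "wf_trm \<sigma> t" "set2_trm t \<subseteq> Inl ` \<alpha> \<union> Inr ` \<beta>"
    and row: "(eval_trm M (case_sum fst fst) t, eval_trm M (case_sum fst snd) t) \<in> \<delta>"
  shows "(eval_trm M (case_sum snd fst) t, eval_trm M (case_sum snd snd) t) \<in> \<delta>"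
proof -
  obtain z where z: "z \<in> carr M" using M by (auto simp: is_alg_def)
  define X where "X = set2_trm t"
  have "finite X" unfolding X_def by (rule finite_vars)
  then obtain n and i :: "_ \<Rightarrow> nat" where i: "inj_on i X"
    using finite_imp_inj_to_nat_seg by metis
  define h where "h = inv_into X i"
  have h: "h (i x) = x" if "x \<in> X" for x using i that by (simp add: h_def)
  \<comment> \<open>One numbering serves both kinds of variables, so \<open>p\<close> and
    \<open>q\<close> have gaps. These are filled with \<open>(z, z)\<close>, which lies in
    \<open>\<alpha>\<close> and \<open>\<beta>\<close> by reflexivity, because the term condition
    wants related entries at every index.\<close>
  define p where "p n = (if h n \<in> X \<and> isl (h n) then projl (h n) else (z, z))" for n
  define q where "q n = (if h n \<in> X \<and> \<not> isl (h n) then projr (h n) else (z, z))" for n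
  have p: "p n \<in> \<alpha>" for n
    using t(2) ConD(2)[OF \<alpha> z] by (auto simp: p_def X_def isl_def)
  have q: "q n \<in> \<beta>" for n
    using t(2) ConD(2)[OF \<beta> z] by (auto simp: q_def X_def isl_def)
  define g :: "('a \<times> 'a) + ('a \<times> 'a) \<Rightarrow> nat + nat" where
    "g x = (if isl x then Inl (i x) else Inr (i x))" for x
  have e: "eval_trm M (case_sum (\<lambda>n. k (p n)) (\<lambda>n. l (q n))) (map_trm id g t)
      = eval_trm M (case_sum k l) t" for k l
    unfolding eval_map_trm
  proof (rule eval_cong)
    fix x assume "x \<in> set2_trm t"
    then have "x \<in> X" by (simp add: X_def)
    then show "(case_sum (\<lambda>n. k (p n)) (\<lambda>n. l (q n)) \<circ> g) x = case_sum k l x"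
      using h[of x] by (cases x) (simp_all add: g_def p_def q_def)
  qed
  have "wf_trm \<sigma> (map_trm id g t)" using t(1) by (simp add: wf_map_trm)
  moreover have "\<forall>n. (fst (p n), snd (p n)) \<in> \<alpha>" "\<forall>n. (fst (q n), snd (q n)) \<in> \<beta>"
    using p q by simp_all
  ultimately show ?thesis
    using tc[unfolded term_condition_def, rule_format, of "map_trm id g t"
        "\<lambda>n. fst (p n)" "\<lambda>n. snd (p n)" "\<lambda>n. fst (q n)" "\<lambda>n. snd (q n)"] row
    unfolding e by blast
qed

text \<open>These are the matrices of the term condition: a left variable \<open>Inl (a, b)\<close>
  takes the value \<open>a\<close> in the first row and \<open>b\<close> in the second, a right
  variable \<open>Inr (c, d)\<close> takes \<open>c\<close> in the first column and \<open>d\<close>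
  in the second.\<close>

definition matrices ::
  "'f signat \<Rightarrow> ('f, 'a) alg \<Rightarrow> ('a \<times> 'a) set \<Rightarrow> ('a \<times> 'a) set \<Rightarrow> (('a \<times> 'a) \<times> ('a \<times> 'a)) set" where
  "matrices \<sigma> M \<alpha> \<beta> =
     {((eval_trm M (case_sum fst fst) t, eval_trm M (case_sum fst snd) t),
       (eval_trm M (case_sum snd fst) t, eval_trm M (case_sum snd snd) t)) | t.
      wf_trm \<sigma> t \<and> set2_trm t \<subseteq> Inl ` \<alpha> \<union> Inr ` \<beta>}"

lemma list_all2_common_preimage:
  assumes "list_all2 (\<lambda>x y. \<exists>t. P t \<and> x = F t \<and> y = G t) xs ys"
  shows "\<exists>ts. (\<forall>t\<in>set ts. P t) \<and> xs = map F ts \<and> ys = map G ts"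
  using assms
proof (induction rule: list_all2_induct)
  case (Cons x xs y ys)
  then obtain t ts where "P t" "x = F t" "y = G t" "\<forall>t\<in>set ts. P t" "xs = map F ts" "ys = map G ts"
    by blast
  then show ?case by (intro exI[of _ "t # ts"]) simp
qed simp

lemma eval_in_Con:
  assumes "\<beta> \<in> Con \<sigma> M" "wf_trm \<sigma> t" "\<And>x. x \<in> set2_trm t \<Longrightarrow> (v x, w x) \<in> \<beta>"
  shows "(eval_trm M v t, eval_trm M w t) \<in> \<beta>"
  using assms(2,3)
proof (induction t)
  case (Op f ts)
  then have "list_all2 (\<lambda>x y. (x, y) \<in> \<beta>) (map (eval_trm M v) ts) (map (eval_trm M w) ts)"
    by (auto simp: list_all2_map1 list_all2_map2 list_all2_same)
  then show ?case using ConD(5)[OF assms(1)] Op.prems by simp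
qed simp

lemma matrices_trancl_Con:
  fixes M :: "('f, 'a) alg"
  assumes \<alpha>: "\<alpha> \<in> Con \<sigma> M" and \<beta>: "\<beta> \<in> Con \<sigma> M"
  shows "(matrices \<sigma> M \<alpha> \<beta>)\<^sup>+ \<in> Con \<sigma> (square M \<beta>)"
proof (rule trancl_compatible_Con)
  let ?P = "\<lambda>t :: ('f, ('a \<times> 'a) + ('a \<times> 'a)) trm. wf_trm \<sigma> t \<and> set2_trm t \<subseteq> Inl ` \<alpha> \<union> Inr ` \<beta>"
  let ?F = "\<lambda>t. (eval_trm M (case_sum fst fst) t, eval_trm M (case_sum fst snd) t)"
  let ?G = "\<lambda>t. (eval_trm M (case_sum snd fst) t, eval_trm M (case_sum snd snd) t)"
  have mem: "(x, y) \<in> matrices \<sigma> M \<alpha> \<beta> \<longleftrightarrow> (\<exists>t. ?P t \<and> x = ?F t \<and> y = ?G t)" for x y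
    unfolding matrices_def by auto
  have rows: "?F t \<in> \<beta> \<and> ?G t \<in> \<beta>" if "?P t" for t
  proof -
    have "(a, a) \<in> \<beta> \<and> (b, b) \<in> \<beta>" if "(a, b) \<in> \<alpha>" for a b
      using that ConD(1)[OF \<alpha>] ConD(2)[OF \<beta>] by blast
    then show ?thesis using that by (intro conjI eval_in_Con[OF \<beta>]) auto
  qed
  show "matrices \<sigma> M \<alpha> \<beta> \<subseteq> carr (square M \<beta>) \<times> carr (square M \<beta>)"
    using rows mem by auto
  show "(x, x) \<in> matrices \<sigma> M \<alpha> \<beta>" if "x \<in> carr (square M \<beta>)" for x
    \<comment> \<open>A right variable takes the same values in both rows, so \<open>Inr x\<close>
      gives the matrix with both rows equal to \<open>x\<close>.\<close>
    unfolding mem using that by (intro exI[of _ "Var (Inr x)"]) auto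
  show "sym (matrices \<sigma> M \<alpha> \<beta>)"
  proof (rule symI)
    fix x y assume "(x, y) \<in> matrices \<sigma> M \<alpha> \<beta>"
    then obtain t where t: "?P t" "x = ?F t" "y = ?G t" unfolding mem by blast
    \<comment> \<open>Swapping the pairs inside the left variables exchanges the two rows; symmetry
      of \<open>\<alpha>\<close> keeps the swapped pairs in \<open>\<alpha>\<close>.\<close>
    let ?g = "map_sum prod.swap id :: ('a \<times> 'a) + ('a \<times> 'a) \<Rightarrow> _"
    have g: "case_sum k l \<circ> ?g = case_sum (k \<circ> prod.swap) l" for k l :: "'a \<times> 'a \<Rightarrow> 'a"
      by (auto split: sum.split simp: fun_eq_iff)
    have s: "fst \<circ> prod.swap = snd" "snd \<circ> prod.swap = fst" by auto
    have "?g ` set2_trm t \<subseteq> Inl ` \<alpha> \<union> Inr ` \<beta>"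
    proof clarify
      fix u assume u: "u \<in> set2_trm t" "?g u \<notin> Inr ` \<beta>"
      then have "u \<in> Inl ` \<alpha> \<union> Inr ` \<beta>" using t(1) by blast
      then show "?g u \<in> Inl ` \<alpha>" using u(2) symD[OF ConD(3)[OF \<alpha>]] by auto
    qed
    then have "?P (map_trm id ?g t)" using t(1) by (simp add: wf_map_trm trm.set_map)
    moreover have "y = ?F (map_trm id ?g t)" "x = ?G (map_trm id ?g t)"
      using t(2,3) by (simp_all add: eval_map_trm g s)
    ultimately show "(y, x) \<in> matrices \<sigma> M \<alpha> \<beta>" unfolding mem by blast
  qed
  show "(oper (square M \<beta>) f xs, oper (square M \<beta>) f ys) \<in> matrices \<sigma> M \<alpha> \<beta>"
    if f: "\<sigma> f = Some (length xs)" and l: "list_all2 (\<lambda>x y. (x, y) \<in> matrices \<sigma> M \<alpha> \<beta>) xs ys"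
    for f xs ys
  proof -
    obtain ts where ts: "\<forall>t\<in>set ts. ?P t" "xs = map ?F ts" "ys = map ?G ts"
      using list_all2_common_preimage[of ?P ?F ?G xs ys] l unfolding mem by blast
    have "?P (Op f ts)" using ts f by auto
    moreover have "oper (square M \<beta>) f xs = ?F (Op f ts)" "oper (square M \<beta>) f ys = ?G (Op f ts)"
      using ts by (simp_all add: oper_square comp_def)
    ultimately show ?thesis unfolding mem by blast
  qed
qed

text \<open>Converse of \<open>term_condition_of_saturated\<close>. Each generator of
  \<open>diag_con\<close> is the matrix of a single left variable, so \<open>diag_con\<close> lies
  in the transitive closure of \<open>matrices\<close>, and the term condition carries
  \<open>\<delta>\<close> across every link of a chain.\<close>

lemma saturated_of_term_condition:
  assumes M: "is_alg \<sigma> M" and \<alpha>: "\<alpha> \<in> Con \<sigma> M" and \<beta>: "\<beta> \<in> Con \<sigma> M"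
    and tc: "term_condition \<sigma> M \<alpha> \<beta> \<delta>"
    and uv: "(u, v) \<in> diag_con \<sigma> M \<alpha> \<beta>" and u: "u \<in> \<delta>"
  shows "v \<in> \<delta>"
proof -
  have "((a, a), (b, b)) \<in> matrices \<sigma> M \<alpha> \<beta>" if "(a, b) \<in> \<alpha>" for a b
    unfolding matrices_def using that by (intro CollectI exI[of _ "Var (Inl (a, b))"]) auto
  then have "diag_con \<sigma> M \<alpha> \<beta> \<subseteq> (matrices \<sigma> M \<alpha> \<beta>)\<^sup>+"
    by (intro diag_con_least matrices_trancl_Con \<alpha> \<beta>) blast
  then have "(u, v) \<in> (matrices \<sigma> M \<alpha> \<beta>)\<^sup>+" using uv by blast
  moreover have step: "y \<in> \<delta>" if "(x, y) \<in> matrices \<sigma> M \<alpha> \<beta>" "x \<in> \<delta>" for x y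
    using that term_condition_pairs[OF M \<alpha> \<beta> tc] unfolding matrices_def by blast
  ultimately show ?thesis
    by (induction rule: trancl_induct) (use u in blast)+
qed

text \<open>Replacing \<open>a\<close> by \<open>b\<close> moves every entry of the matrix only
  within \<open>\<delta>\<close>, so the second row is in \<open>\<delta>\<close> as soon as the
  first is.\<close>

lemma term_condition_self:
  fixes \<sigma> :: "'f signat"
  assumes \<beta>: "\<beta> \<in> Con \<sigma> M" and \<delta>: "\<delta> \<in> Con \<sigma> M"
  shows "term_condition \<sigma> M \<delta> \<beta> \<delta>"
  unfolding term_condition_def
proof (intro allI impI, elim conjE)
  fix t :: "('f, nat + nat) trm" and a b c d
  assume wf: "wf_trm \<sigma> t" and ab: "\<forall>i. (a i, b i) \<in> \<delta>" and cd: "\<forall>j. (c j, d j) \<in> \<beta>"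
    and *: "(eval_trm M (case_sum a c) t, eval_trm M (case_sum a d) t) \<in> \<delta>"
  have "(eval_trm M (case_sum a e) t, eval_trm M (case_sum b e) t) \<in> \<delta>"
    if "\<And>j. e j \<in> carr M" for e
    by (rule eval_Con[OF \<delta> wf]) (use ab ConD(2)[OF \<delta>] that in \<open>auto split: sum.split\<close>)
  moreover have "c j \<in> carr M" "d j \<in> carr M" for j using cd ConD(1)[OF \<beta>] by blast+
  ultimately show "(eval_trm M (case_sum b c) t, eval_trm M (case_sum b d) t) \<in> \<delta>"
    using * ConD(3,4)[OF \<delta>] by (meson symE transE)
qed

text \<open>The join is a transitive closure, so its diagonal generators split into chains of
  \<open>\<alpha>\<close>-steps and \<open>\<delta>\<close>-steps. Saturation of
  \<open>\<delta>\<close> holds for the former by assumption and for the latter by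
  \<open>term_condition_self\<close>, hence along whole chains.\<close>

lemma term_condition_join_left:
  assumes M: "is_alg \<sigma> M" and \<alpha>: "\<alpha> \<in> Con \<sigma> M" and \<beta>: "\<beta> \<in> Con \<sigma> M" and \<delta>: "\<delta> \<in> Con \<sigma> M"
    and tc: "term_condition \<sigma> M \<alpha> \<beta> \<delta>"
  shows "term_condition \<sigma> M (Cg \<sigma> M (\<alpha> \<union> \<delta>)) \<beta> \<delta>"
proof (rule term_condition_of_saturated[OF M _ \<beta>])
  show "Cg \<sigma> M (\<alpha> \<union> \<delta>) \<in> Con \<sigma> M"
    using ConD(1)[OF \<alpha>] ConD(1)[OF \<delta>] by (intro Cg_Con M) auto
  let ?\<Sigma> = "(diag_con \<sigma> M \<alpha> \<beta> \<union> diag_con \<sigma> M \<delta> \<beta>)\<^sup>+"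
  have \<Sigma>: "?\<Sigma> \<in> Con \<sigma> (square M \<beta>)"
    by (intro trancl_Con is_alg_square diag_con_Con M \<alpha> \<beta> \<delta>)
  have "Cg \<sigma> M (\<alpha> \<union> \<delta>) \<subseteq> (\<alpha> \<union> \<delta>)\<^sup>+" by (intro Cg_least trancl_Con M \<alpha> \<delta>) auto
  moreover have "((a, a), (b, b)) \<in> ?\<Sigma>" if "(a, b) \<in> (\<alpha> \<union> \<delta>)\<^sup>+" for a b
    using that
  proof (induction rule: trancl_induct)
    case (base y)
    then show ?case using diag_con_diag by (intro r_into_trancl) fast
  next
    case (step y z)
    then have "((y, y), (z, z)) \<in> diag_con \<sigma> M \<alpha> \<beta> \<union> diag_con \<sigma> M \<delta> \<beta>"
      using diag_con_diag by fast
    with step.IH show ?case by (rule trancl_into_trancl)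
  qed
  ultimately have "diag_con \<sigma> M (Cg \<sigma> M (\<alpha> \<union> \<delta>)) \<beta> \<subseteq> ?\<Sigma>"
    by (intro diag_con_least \<Sigma>) blast
  moreover have "v \<in> \<delta>" if "(u, v) \<in> ?\<Sigma>" "u \<in> \<delta>" for u v
    using that
  proof (induction rule: trancl_induct)
    case (base y)
    then show ?case
      using saturated_of_term_condition[OF M \<alpha> \<beta> tc]
        saturated_of_term_condition[OF M \<delta> \<beta> term_condition_self[OF \<beta> \<delta>]] by blast
  next
    case (step y z)
    then show ?case
      using saturated_of_term_condition[OF M \<alpha> \<beta> tc]
        saturated_of_term_condition[OF M \<delta> \<beta> term_condition_self[OF \<beta> \<delta>]] by blast
  qed
  ultimately show "v \<in> \<delta>" if "(u, v) \<in> diag_con \<sigma> M (Cg \<sigma> M (\<alpha> \<union> \<delta>)) \<beta>" "u \<in> \<delta>" for u v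
    using that by blast
qed

section \<open>The commutator in a congruence-modular class\<close>

text \<open>Gumm's shifting principle replaces Day terms throughout.\<close>

lemma shifting:
  assumes "con_modular \<sigma> M" and \<Phi>: "\<Phi> \<in> Con \<sigma> M" and \<Psi>: "\<Psi> \<in> Con \<sigma> M" and \<Gamma>: "\<Gamma> \<in> Con \<sigma> M"
    and le: "\<Phi> \<inter> \<Psi> \<subseteq> \<Gamma>"
    and p: "(p, r) \<in> \<Phi>" "(q, s) \<in> \<Phi>" "(p, q) \<in> \<Psi>" "(r, s) \<in> \<Psi>" "(p, q) \<in> \<Gamma>"
  shows "(r, s) \<in> \<Gamma>"
proof -
  let ?J = "Cg \<sigma> M (\<Phi> \<union> (\<Gamma> \<inter> \<Psi>))"
  have J: "x \<in> ?J" if "x \<in> \<Phi> \<union> (\<Gamma> \<inter> \<Psi>)" for x using that Cg_superset[of "\<Phi> \<union> (\<Gamma> \<inter> \<Psi>)" \<sigma> M] by blast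
  have trans: "(x, z) \<in> ?J" if "(x, y) \<in> ?J" "(y, z) \<in> ?J" for x y z
    unfolding Cg_def
  proof
    fix \<theta> assume \<theta>: "\<theta> \<in> {\<theta> \<in> Con \<sigma> M. \<Phi> \<union> (\<Gamma> \<inter> \<Psi>) \<subseteq> \<theta>}"
    then have "trans \<theta>" "(x, y) \<in> \<theta>" "(y, z) \<in> \<theta>"
      using that ConD(4) unfolding Cg_def by blast+
    then show "(x, z) \<in> \<theta>" by (rule transD)
  qed
  have "(r, p) \<in> \<Phi>" using p(1) ConD(3)[OF \<Phi>] by (meson symE)
  then have "(r, p) \<in> ?J" "(p, q) \<in> ?J" "(q, s) \<in> ?J" using p by (simp_all add: J)
  then have "(r, s) \<in> ?J" using trans by blast
  then have "(r, s) \<in> \<Psi> \<inter> ?J" using p(4) by blast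
  \<comment> \<open>The path from \<open>r\<close> through \<open>p\<close> and \<open>q\<close> to
    \<open>s\<close> has put \<open>(r, s)\<close> into \<open>?J\<close>. The modular law for
    \<open>\<Gamma> \<inter> \<Psi> \<subseteq> \<Psi>\<close> now rewrites the meet as a congruence
    whose generators all lie in \<open>\<Gamma>\<close>.\<close>
  also have "\<Psi> \<inter> ?J = Cg \<sigma> M ((\<Psi> \<inter> \<Phi>) \<union> (\<Gamma> \<inter> \<Psi>))"
    using assms(1) \<Phi> \<Psi> Int_Con[OF \<Gamma> \<Psi>] unfolding con_modular_def by blast
  also have "\<dots> \<subseteq> \<Gamma>" using le by (intro Cg_least \<Gamma>) blast
  finally show ?thesis .
qed

section \<open>Commutator calculus in a class with modular congruence lattices\<close>

locale modular_class =
  fixes \<sigma> :: "'f signat" and E :: "'f identities"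
  assumes wf: "wf_identities \<sigma> E" and cm: "congruence_modular \<sigma> E"
begin

lemma modular: "in_class \<sigma> E M \<Longrightarrow> con_modular \<sigma> M"
  by (rule congruence_modular_all[OF cm wf])

text \<open>The projection kernels \<open>?\<eta>0\<close> and \<open>?\<eta>1\<close> meet in
  equality. Shifting along \<open>?\<eta>1\<close> replaces the common left entry \<open>x\<close>
  by \<open>y\<close>, and the first row becomes \<open>(y, y)\<close>. That row lies in the
  commutator by reflexivity, so saturation gives the same for the second row
  \<open>(y, z)\<close>.\<close>

lemma diag_con_same_left:
  assumes M: "in_class \<sigma> E M" and \<alpha>: "\<alpha> \<in> Con \<sigma> M" and \<beta>: "\<beta> \<in> Con \<sigma> M"
    and xyz: "((x, y), (x, z)) \<in> diag_con \<sigma> M \<alpha> \<beta>"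
  shows "(y, z) \<in> commutator \<sigma> M \<alpha> \<beta>"
proof -
  have alg: "is_alg \<sigma> M" using M by (simp add: in_class_def)
  let ?R = "square M \<beta>" and ?\<Delta> = "diag_con \<sigma> M \<alpha> \<beta>"
  let ?\<eta>0 = "inv_con ?R fst (Delta M)" and ?\<eta>1 = "inv_con ?R snd (Delta M)"
  have \<eta>: "?\<eta>0 \<in> Con \<sigma> ?R" "?\<eta>1 \<in> Con \<sigma> ?R"
    using inv_con_Con[OF is_alg_square[OF alg \<beta>] _ Delta_Con[OF alg]] morphism_square[OF \<beta>]
    by blast+
  note \<Delta> = diag_con_Con[OF alg \<alpha> \<beta>]
  have c: "(x, y) \<in> \<beta>" "(x, z) \<in> \<beta>" using diag_con_columns[OF alg \<alpha> \<beta> xyz] by blast+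
  then have carr: "x \<in> carr M" "y \<in> carr M" "z \<in> carr M" using ConD(1)[OF \<beta>] by blast+
  have yz: "(y, y) \<in> \<beta>" "(y, z) \<in> \<beta>"
    using c ConD(2)[OF \<beta> carr(2)] ConD(3,4)[OF \<beta>] by (meson symE transE)+
  have "((y, y), (y, z)) \<in> ?\<Delta>"
  proof (rule shifting[OF modular[OF in_class_square[OF M \<beta>]] \<eta>(2,1) \<Delta>])
    show "?\<eta>1 \<inter> ?\<eta>0 \<subseteq> ?\<Delta>" using ConD(2)[OF \<Delta>] by (auto simp: inv_con_def Delta_def)
    show "((x, y), (y, y)) \<in> ?\<eta>1" "((x, z), (y, z)) \<in> ?\<eta>1" "((x, y), (x, z)) \<in> ?\<eta>0"
      "((y, y), (y, z)) \<in> ?\<eta>0"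
      using c yz carr by (simp_all add: inv_con_def Delta_def Id_on_iff)
  qed (rule xyz)
  moreover have "(y, y) \<in> commutator \<sigma> M \<alpha> \<beta>"
    using ConD(2)[OF commutator_least(1)[OF \<alpha> \<beta>] carr(2)] .
  ultimately show ?thesis
    by (rule saturated_of_term_condition[OF alg \<alpha> \<beta> commutator_least(2)[OF \<alpha> \<beta>]])
qed

text \<open>Passing from the commutator to a larger \<open>\<delta>\<close> is where shifting is
  essential: given a matrix with rows \<open>(p, q)\<close> and \<open>(r, s)\<close>, the edge from
  \<open>(p, p)\<close> to \<open>(p, q)\<close> is shifted along \<open>diag_con\<close> to the
  edge from \<open>(r, r)\<close> to \<open>(r, s)\<close>. The required inclusion of the meet is
  \<open>diag_con_same_left\<close>.\<close>

lemma term_condition_of_commutator_le: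
  assumes M: "in_class \<sigma> E M" and \<alpha>: "\<alpha> \<in> Con \<sigma> M" and \<beta>: "\<beta> \<in> Con \<sigma> M" and \<delta>: "\<delta> \<in> Con \<sigma> M"
    and le: "commutator \<sigma> M \<alpha> \<beta> \<subseteq> \<delta>"
  shows "term_condition \<sigma> M \<alpha> \<beta> \<delta>"
proof (rule term_condition_of_saturated)
  show alg: "is_alg \<sigma> M" using M by (simp add: in_class_def)
  let ?R = "square M \<beta>" and ?\<Delta> = "diag_con \<sigma> M \<alpha> \<beta>"
  let ?\<eta>0 = "inv_con ?R fst (Delta M)" and ?\<delta>1 = "inv_con ?R snd \<delta>"
  have con: "?\<eta>0 \<in> Con \<sigma> ?R" "?\<delta>1 \<in> Con \<sigma> ?R"
    using inv_con_Con[OF is_alg_square[OF alg \<beta>]] Delta_Con[OF alg] \<delta> morphism_square[OF \<beta>]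
    by blast+
  fix u v assume "(u, v) \<in> ?\<Delta>" "u \<in> \<delta>"
  moreover obtain p q r s where uv: "u = (p, q)" "v = (r, s)" by fastforce
  ultimately have pqrs: "((p, q), (r, s)) \<in> ?\<Delta>" and pq: "(p, q) \<in> \<delta>" by simp_all
  note c = diag_con_columns[OF alg \<alpha> \<beta> pqrs]
  have carr: "p \<in> carr M" "q \<in> carr M" "r \<in> carr M" "s \<in> carr M"
    using c(1,2) ConD(1)[OF \<beta>] by blast+
  have diag: "(p, p) \<in> \<beta>" "(r, r) \<in> \<beta>" using ConD(2)[OF \<beta>] carr by blast+
  have "((r, r), (r, s)) \<in> ?\<delta>1"
  proof (rule shifting[OF modular[OF in_class_square[OF M \<beta>]] diag_con_Con[OF alg \<alpha> \<beta>] con])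
    show "?\<Delta> \<inter> ?\<eta>0 \<subseteq> ?\<delta>1"
    proof clarify
      fix x y x' z assume *: "((x, y), (x', z)) \<in> ?\<Delta>" "((x, y), (x', z)) \<in> ?\<eta>0"
      then have "x' = x" by (auto simp: inv_con_def Delta_def)
      then have "(y, z) \<in> \<delta>" using diag_con_same_left[OF M \<alpha> \<beta>] * le by blast
      then show "((x, y), (x', z)) \<in> ?\<delta>1" using *(2) by (simp add: inv_con_def)
    qed
    show "((p, p), (r, r)) \<in> ?\<Delta>" using c(3) by (rule diag_con_diag)
    show "((p, p), (p, q)) \<in> ?\<eta>0" "((r, r), (r, s)) \<in> ?\<eta>0" "((p, p), (p, q)) \<in> ?\<delta>1"
      using c diag carr pq by (simp_all add: inv_con_def Delta_def Id_on_iff)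
  qed (rule pqrs)
  then show "v \<in> \<delta>" using uv by (simp add: inv_con_def)
qed (rule \<alpha> \<beta>)+

text \<open>Symmetry of the commutator, by shifting in the algebra of \<open>2 \<times> 2\<close> matrices whose rows are
  related by \<open>diag_con\<close>: a matrix is determined modulo \<open>\<delta>\<close> by its first row and first column.\<close>

lemma term_condition_commute:
  fixes M :: "('f, 'a) alg"
  assumes M: "in_class \<sigma> E M" and \<alpha>: "\<alpha> \<in> Con \<sigma> M" and \<beta>: "\<beta> \<in> Con \<sigma> M" and \<delta>: "\<delta> \<in> Con \<sigma> M"
    and le: "commutator \<sigma> M \<alpha> \<beta> \<subseteq> \<delta>"
  shows "term_condition \<sigma> M \<beta> \<alpha> \<delta>"
proof -
  have alg: "is_alg \<sigma> M" using M by (simp add: in_class_def)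
  let ?R = "square M \<beta>" and ?\<Delta> = "diag_con \<sigma> M \<alpha> \<beta>"
  let ?Q = "square ?R ?\<Delta>"
  note \<Delta> = diag_con_Con[OF alg \<alpha> \<beta>]
  note algR = is_alg_square[OF alg \<beta>]
  note algQ = is_alg_square[OF algR \<Delta>]
  note inQ = in_class_square[OF in_class_square[OF M \<beta>] \<Delta>]
  \<comment> \<open>On matrices, \<open>?\<rho>\<close> is equality of first rows,
    \<open>?\<kappa>\<close> is equality of first columns, and \<open>?\<gamma>\<close> compares the
    lower right entries modulo \<open>\<delta>\<close>.\<close>
  let ?\<rho> = "inv_con ?Q fst (Delta ?R)"
  let ?\<eta>0 = "inv_con ?R fst (Delta M)"
  let ?\<kappa> = "inv_con ?Q fst ?\<eta>0 \<inter> inv_con ?Q snd ?\<eta>0"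
  let ?\<gamma> = "inv_con ?Q snd (inv_con ?R snd \<delta>)"
  have \<eta>0: "?\<eta>0 \<in> Con \<sigma> ?R"
    by (rule inv_con_Con[OF algR morphism_square(1)[OF \<beta>] Delta_Con[OF alg]])
  have \<rho>: "?\<rho> \<in> Con \<sigma> ?Q"
    by (rule inv_con_Con[OF algQ morphism_square(1)[OF \<Delta>] Delta_Con[OF algR]])
  have \<kappa>: "?\<kappa> \<in> Con \<sigma> ?Q"
    by (intro Int_Con inv_con_Con[OF algQ morphism_square(1)[OF \<Delta>] \<eta>0]
        inv_con_Con[OF algQ morphism_square(2)[OF \<Delta>] \<eta>0])
  have \<gamma>: "?\<gamma> \<in> Con \<sigma> ?Q"
    by (rule inv_con_Con[OF algQ morphism_square(2)[OF \<Delta>]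
          inv_con_Con[OF algR morphism_square(2)[OF \<beta>] \<delta>]])
  \<comment> \<open>With equal first rows and equal first columns, transitivity through the common
    first row relates \<open>(c, d)\<close> to \<open>(c, d')\<close>, and
    \<open>diag_con_same_left\<close> applies.\<close>
  have \<kappa>\<rho>: "?\<kappa> \<inter> ?\<rho> \<subseteq> ?\<gamma>"
  proof clarify
    fix a b c d a' b' c' d' :: 'a
    let ?m = "(((a, b), (c, d)), ((a', b'), (c', d')))"
    assume *: "?m \<in> ?\<rho>" "?m \<in> inv_con ?Q snd ?\<eta>0"
    then have e: "a' = a" "b' = b" "c' = c" by (auto simp: inv_con_def Delta_def)
    have m: "((a, b), (c, d)) \<in> ?\<Delta>" "((a, b), (c, d')) \<in> ?\<Delta>"
      using *(1) e by (auto simp: inv_con_def)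
    then have "((c, d), (c, d')) \<in> ?\<Delta>" using ConD(3,4)[OF \<Delta>] by (meson symE transE)
    then have "(d, d') \<in> \<delta>" using diag_con_same_left[OF M \<alpha> \<beta>] le by blast
    then show "?m \<in> ?\<gamma>"
      using m e diag_con_columns[OF alg \<alpha> \<beta> m(1)] diag_con_columns[OF alg \<alpha> \<beta> m(2)]
      by (simp add: inv_con_def)
  qed
  \<comment> \<open>This transfers \<open>\<delta>\<close> from the right column to the left one.
    Along \<open>?\<kappa>\<close>, which fixes first columns, each right column is overwritten by a
    copy of the left column, so the lower right entries \<open>x\<close>, \<open>u\<close> turn into
    \<open>y\<close>, \<open>z\<close>.\<close>
  have column: "(y, z) \<in> \<delta>" if m: "((y, x), (z, u)) \<in> ?\<Delta>" and xu: "(x, u) \<in> \<delta>" for x y z u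
  proof -
    note c = diag_con_columns[OF alg \<alpha> \<beta> m]
    have carr: "y \<in> carr M" "x \<in> carr M" "z \<in> carr M" "u \<in> carr M"
      using c(1,2) ConD(1)[OF \<beta>] by blast+
    have diag: "(y, y) \<in> \<beta>" "(z, z) \<in> \<beta>" using ConD(2)[OF \<beta>] carr by blast+
    have rows: "((y, y), (y, y)) \<in> ?\<Delta>" "((y, x), (y, x)) \<in> ?\<Delta>"
      "((y, y), (z, z)) \<in> ?\<Delta>"
      using ConD(2)[OF \<Delta>] diag c diag_con_diag by auto
    have "(((y, y), (y, y)), ((y, y), (z, z))) \<in> ?\<gamma>"
    proof (rule shifting[OF modular[OF inQ] \<kappa> \<rho> \<gamma> \<kappa>\<rho>])
      show "(((y, x), (y, x)), ((y, y), (y, y))) \<in> ?\<kappa>"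
        "(((y, x), (z, u)), ((y, y), (z, z))) \<in> ?\<kappa>"
        "(((y, x), (y, x)), ((y, x), (z, u))) \<in> ?\<rho>"
        "(((y, y), (y, y)), ((y, y), (z, z))) \<in> ?\<rho>"
        "(((y, x), (y, x)), ((y, x), (z, u))) \<in> ?\<gamma>"
        using rows m xu diag carr c by (simp_all add: inv_con_def Delta_def Id_on_iff)
    qed
    then show ?thesis by (simp add: inv_con_def)
  qed
  show ?thesis
    unfolding term_condition_def
  proof (intro allI impI, elim conjE)
    fix t :: "('f, nat + nat) trm" and a b c d
    assume t: "wf_trm \<sigma> t" and ab: "\<forall>i. (a i, b i) \<in> \<beta>" and cd: "\<forall>j. (c j, d j) \<in> \<alpha>"
      and row: "(eval_trm M (case_sum a c) t, eval_trm M (case_sum a d) t) \<in> \<delta>"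
    let ?g = "case_sum Inr Inl :: nat + nat \<Rightarrow> nat + nat"
    have g: "case_sum k l \<circ> ?g = case_sum l k" for k l :: "nat \<Rightarrow> 'a"
      by (auto split: sum.split simp: fun_eq_iff)
    have ba: "\<And>i. (b i, a i) \<in> \<beta>" using ab ConD(3)[OF \<beta>] by (meson symE)
    have t': "wf_trm \<sigma> (map_trm id ?g t)" using t by (simp add: wf_map_trm)
    \<comment> \<open>Exchanging the two kinds of variables transposes the matrix. As
      \<open>column\<close> works from right to left, \<open>b\<close> and \<open>a\<close> are
      supplied in reversed order.\<close>
    show "(eval_trm M (case_sum b c) t, eval_trm M (case_sum b d) t) \<in> \<delta>"
      using eval_diag_con[OF alg \<alpha> \<beta> t', of c d b a] ba cd row column
      by (simp add: eval_map_trm g)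
  qed
qed

text \<open>Joins with \<open>\<delta>\<close> can be added only on the left of a term condition, so
  \<open>\<beta>\<close> is brought there by symmetry and enlarged, then a second application of
  symmetry brings \<open>\<alpha>\<close> back to be enlarged in turn.\<close>

lemma commutator_join:
  assumes M: "in_class \<sigma> E M" and \<alpha>: "\<alpha> \<in> Con \<sigma> M" and \<beta>: "\<beta> \<in> Con \<sigma> M" and \<delta>: "\<delta> \<in> Con \<sigma> M"
    and le: "commutator \<sigma> M \<alpha> \<beta> \<subseteq> \<delta>"
  shows "commutator \<sigma> M (Cg \<sigma> M (\<alpha> \<union> \<delta>)) (Cg \<sigma> M (\<beta> \<union> \<delta>)) \<subseteq> \<delta>"
proof -
  have alg: "is_alg \<sigma> M" using M by (simp add: in_class_def)
  have \<alpha>': "Cg \<sigma> M (\<alpha> \<union> \<delta>) \<in> Con \<sigma> M" and \<beta>': "Cg \<sigma> M (\<beta> \<union> \<delta>) \<in> Con \<sigma> M"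
    using ConD(1)[OF \<alpha>] ConD(1)[OF \<beta>] ConD(1)[OF \<delta>] by (auto intro!: Cg_Con alg)
  have "term_condition \<sigma> M \<beta> \<alpha> \<delta>" by (rule term_condition_commute[OF M \<alpha> \<beta> \<delta> le])
  then have "term_condition \<sigma> M (Cg \<sigma> M (\<beta> \<union> \<delta>)) \<alpha> \<delta>"
    by (rule term_condition_join_left[OF alg \<beta> \<alpha> \<delta>])
  then have "commutator \<sigma> M (Cg \<sigma> M (\<beta> \<union> \<delta>)) \<alpha> \<subseteq> \<delta>"
    by (rule commutator_least(3)[OF \<beta>' \<alpha> \<delta>])
  then have "term_condition \<sigma> M \<alpha> (Cg \<sigma> M (\<beta> \<union> \<delta>)) \<delta>"
    by (rule term_condition_commute[OF M \<beta>' \<alpha> \<delta>])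
  then have "term_condition \<sigma> M (Cg \<sigma> M (\<alpha> \<union> \<delta>)) (Cg \<sigma> M (\<beta> \<union> \<delta>)) \<delta>"
    by (rule term_condition_join_left[OF alg \<alpha> \<beta>' \<delta>])
  then show ?thesis by (rule commutator_least(3)[OF \<alpha>' \<beta>' \<delta>])
qed

text \<open>This form of primality transfers along surjective morphisms: congruences above
  \<open>\<phi>\<close> and term conditions can be pulled back, and no commutator has to be computed
  in the quotient. For the converse direction \<open>\<alpha>\<close> and \<open>\<beta>\<close> are
  replaced by their joins with \<open>\<phi>\<close>, using \<open>commutator_join\<close>.\<close>

lemma Spec_iff:
  assumes M: "in_class \<sigma> E M"
  shows "\<phi> \<in> Spec \<sigma> M \<longleftrightarrow> \<phi> \<in> Con \<sigma> M \<and> \<phi> \<noteq> Nabla M \<and>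
    (\<forall>\<alpha>\<in>Con \<sigma> M. \<forall>\<beta>\<in>Con \<sigma> M.
      \<phi> \<subseteq> \<alpha> \<longrightarrow> \<phi> \<subseteq> \<beta> \<longrightarrow> term_condition \<sigma> M \<alpha> \<beta> \<phi> \<longrightarrow> \<alpha> \<subseteq> \<phi> \<or> \<beta> \<subseteq> \<phi>)"
    (is "_ \<longleftrightarrow> ?con \<and> ?ne \<and> ?prime")
proof
  assume \<phi>: "\<phi> \<in> Spec \<sigma> M"
  then have con: "\<phi> \<in> Con \<sigma> M" by (simp add: Spec_def)
  have "\<alpha> \<subseteq> \<phi> \<or> \<beta> \<subseteq> \<phi>"
    if "\<alpha> \<in> Con \<sigma> M" "\<beta> \<in> Con \<sigma> M" "term_condition \<sigma> M \<alpha> \<beta> \<phi>" for \<alpha> \<beta>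
    using commutator_least(3)[OF that(1,2) con that(3)] \<phi> that(1,2) by (simp add: Spec_def)
  then show "?con \<and> ?ne \<and> ?prime" using \<phi> unfolding Spec_def by blast
next
  assume \<phi>: "?con \<and> ?ne \<and> ?prime"
  then have con: "\<phi> \<in> Con \<sigma> M" by blast
  have alg: "is_alg \<sigma> M" using M by (simp add: in_class_def)
  have "\<alpha> \<subseteq> \<phi> \<or> \<beta> \<subseteq> \<phi>"
    if \<alpha>: "\<alpha> \<in> Con \<sigma> M" and \<beta>: "\<beta> \<in> Con \<sigma> M" and le: "commutator \<sigma> M \<alpha> \<beta> \<subseteq> \<phi>" for \<alpha> \<beta>
  proof -
    let ?\<alpha> = "Cg \<sigma> M (\<alpha> \<union> \<phi>)" and ?\<beta> = "Cg \<sigma> M (\<beta> \<union> \<phi>)"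
    have c: "?\<alpha> \<in> Con \<sigma> M" "?\<beta> \<in> Con \<sigma> M"
      using ConD(1)[OF \<alpha>] ConD(1)[OF \<beta>] ConD(1)[OF con] by (auto intro!: Cg_Con alg)
    have "term_condition \<sigma> M ?\<alpha> ?\<beta> \<phi>"
      by (rule term_condition_of_commutator_le[OF M c con commutator_join[OF M \<alpha> \<beta> con le]])
    moreover have "\<alpha> \<subseteq> ?\<alpha>" "\<phi> \<subseteq> ?\<alpha>" "\<beta> \<subseteq> ?\<beta>" "\<phi> \<subseteq> ?\<beta>"
      using Cg_superset[of "\<alpha> \<union> \<phi>" \<sigma> M] Cg_superset[of "\<beta> \<union> \<phi>" \<sigma> M] by simp_all
    ultimately show ?thesis using \<phi> c by (meson subset_trans)
  qed
  then show "\<phi> \<in> Spec \<sigma> M" using \<phi> by (simp add: Spec_def)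
qed

end

section \<open>Surjective morphisms and spectra\<close>

lemma morphism_eval_case_sum:
  assumes "is_alg \<sigma> M" "morphism \<sigma> M N \<pi>" "wf_trm \<sigma> t" "range a \<subseteq> carr M" "range c \<subseteq> carr M"
  shows "eval_trm N (case_sum (\<pi> \<circ> a) (\<pi> \<circ> c)) t = \<pi> (eval_trm M (case_sum a c) t)"
proof -
  have "range (case_sum a c) \<subseteq> carr M" using assms(4,5) by (auto simp: image_subset_iff split: sum.split)
  moreover have "\<pi> \<circ> case_sum a c = case_sum (\<pi> \<circ> a) (\<pi> \<circ> c)"
    by (auto split: sum.split simp: fun_eq_iff)
  ultimately show ?thesis using eval_morphism[OF assms(1,2) _ assms(3)] by metis
qed

text \<open>Morphisms commute with term evaluation. Besides projections onto quotients, this is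
  applied to \<open>f\<close> itself in \<open>prime_above\<close>.\<close>

lemma term_condition_pullback:
  fixes M :: "('f, 'a) alg"
  assumes alg: "is_alg \<sigma> M" and "morphism \<sigma> M N f" and "term_condition \<sigma> N \<alpha> \<beta> \<delta>"
  shows "term_condition \<sigma> M (inv_con M f \<alpha>) (inv_con M f \<beta>) (inv_con M f \<delta>)"
  unfolding term_condition_def
proof (intro allI impI, elim conjE)
  fix t :: "('f, nat + nat) trm" and a b c d
  assume t: "wf_trm \<sigma> t" and *: "\<forall>i. (a i, b i) \<in> inv_con M f \<alpha>" "\<forall>j. (c j, d j) \<in> inv_con M f \<beta>"
    and row: "(eval_trm M (case_sum a c) t, eval_trm M (case_sum a d) t) \<in> inv_con M f \<delta>"
  note ev = morphism_eval_case_sum[OF alg assms(2) t]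
  have r: "range a \<subseteq> carr M" "range b \<subseteq> carr M" "range c \<subseteq> carr M" "range d \<subseteq> carr M"
    using * by (auto simp: inv_con_def)
  have "\<forall>i. ((f \<circ> a) i, (f \<circ> b) i) \<in> \<alpha>" "\<forall>j. ((f \<circ> c) j, (f \<circ> d) j) \<in> \<beta>"
    "(eval_trm N (case_sum (f \<circ> a) (f \<circ> c)) t, eval_trm N (case_sum (f \<circ> a) (f \<circ> d)) t) \<in> \<delta>"
    using * row ev r by (simp_all add: inv_con_def)
  then have "(eval_trm N (case_sum (f \<circ> b) (f \<circ> c)) t, eval_trm N (case_sum (f \<circ> b) (f \<circ> d)) t) \<in> \<delta>"
    using assms(3) t unfolding term_condition_def by blast
  moreover have "eval_trm M (case_sum b e) t \<in> carr M" if "range e \<subseteq> carr M" for e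
    using that r(2) by (intro eval_in_carr[OF alg _ t]) (auto simp: image_subset_iff split: sum.split)
  ultimately show "(eval_trm M (case_sum b c) t, eval_trm M (case_sum b d) t) \<in> inv_con M f \<delta>"
    using ev r by (simp add: inv_con_def)
qed

lemma inv_con_mono: "\<psi> \<subseteq> \<psi>' \<Longrightarrow> inv_con M f \<psi> \<subseteq> inv_con M f \<psi>'"
  by (auto simp: inv_con_def)

text \<open>An arbitrary surjection stands for the projection onto a quotient, which keeps the
  chosen representatives in \<open>quot_alg\<close> out of the arguments.\<close>

locale surjective_morphism =
  fixes \<sigma> :: "'f signat" and M :: "('f, 'a) alg" and N :: "('f, 'b) alg" and \<pi> :: "'a \<Rightarrow> 'b"
  assumes algM: "is_alg \<sigma> M" and mor: "morphism \<sigma> M N \<pi>" and surj: "\<pi> ` carr M = carr N"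
begin

lemma inv_into_surj:
  assumes "y \<in> carr N"
  shows "inv_into (carr M) \<pi> y \<in> carr M" "\<pi> (inv_into (carr M) \<pi> y) = y"
proof -
  have "y \<in> \<pi> ` carr M" using assms surj by simp
  then show "inv_into (carr M) \<pi> y \<in> carr M" "\<pi> (inv_into (carr M) \<pi> y) = y"
    by (rule inv_into_into, rule f_inv_into_f)
qed

lemma is_alg_image: "is_alg \<sigma> N"
  unfolding is_alg_def
proof (intro conjI allI impI)
  have "carr M \<noteq> {}" using algM unfolding is_alg_def by (rule conjunct1)
  then show "carr N \<noteq> {}" using surj by (metis image_is_empty)
  fix f ys assume f: "\<sigma> f = Some (length ys) \<and> set ys \<subseteq> carr N"
  define xs where "xs = map (inv_into (carr M) \<pi>) ys"
  have *: "inv_into (carr M) \<pi> y \<in> carr M" "\<pi> (inv_into (carr M) \<pi> y) = y" if "y \<in> set ys" for y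
    using f that by (intro inv_into_surj; blast)+
  have xs: "\<sigma> f = Some (length xs) \<and> set xs \<subseteq> carr M"
    using *(1) f unfolding xs_def by (simp add: image_subset_iff)
  have "map \<pi> xs = ys"
    unfolding xs_def map_map by (rule map_idI) (simp add: *(2))
  moreover have "oper M f xs \<in> carr M" using algM xs by (simp only: is_alg_def)
  moreover have "\<pi> (oper M f xs) = oper N f (map \<pi> xs)"
    using mor xs by (simp only: morphism_def)
  ultimately have "oper M f xs \<in> carr M" "\<pi> (oper M f xs) = oper N f ys" by simp_all
  then show "oper N f ys \<in> carr N" using surj by (metis imageI)
qed

lemma lift_seq:
  fixes v :: "'c \<Rightarrow> 'b"
  assumes "range v \<subseteq> carr N"
  obtains u where "range u \<subseteq> carr M" "v = \<pi> \<circ> u"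
proof
  show "range (inv_into (carr M) \<pi> \<circ> v) \<subseteq> carr M" "v = \<pi> \<circ> (inv_into (carr M) \<pi> \<circ> v)"
    using assms inv_into_surj by (auto simp: fun_eq_iff image_subset_iff)
qed

lemma in_class_image:
  assumes "in_class \<sigma> E M" "wf_identities \<sigma> E"
  shows "in_class \<sigma> E N"
proof -
  have "eval_trm N v s = eval_trm N v t"
    if st: "(s, t) \<in> E" and v: "range v \<subseteq> carr N" for s t and v :: "nat \<Rightarrow> 'b"
  proof -
    obtain u where u: "range u \<subseteq> carr M" "v = \<pi> \<circ> u" using lift_seq[OF v] .
    have "wf_trm \<sigma> s" "wf_trm \<sigma> t" using assms(2) st by (auto simp: wf_identities_def)
    moreover have "eval_trm M u s = eval_trm M u t"
      using assms(1) st u(1) unfolding in_class_def by blast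
    ultimately show ?thesis using eval_morphism[OF algM mor u(1)] u(2) by metis
  qed
  then show ?thesis using is_alg_image by (auto simp: in_class_def)
qed

lemma inv_con_le_iff:
  assumes "\<psi> \<subseteq> carr N \<times> carr N"
  shows "inv_con M \<pi> \<psi> \<subseteq> inv_con M \<pi> \<psi>' \<longleftrightarrow> \<psi> \<subseteq> \<psi>'"
proof
  assume *: "inv_con M \<pi> \<psi> \<subseteq> inv_con M \<pi> \<psi>'"
  show "\<psi> \<subseteq> \<psi>'"
  proof clarify
    fix u v assume uv: "(u, v) \<in> \<psi>"
    then have "u \<in> \<pi> ` carr M" "v \<in> \<pi> ` carr M" using assms surj by auto
    then obtain x y where xy: "x \<in> carr M" "y \<in> carr M" "u = \<pi> x" "v = \<pi> y" by blast
    then have "(x, y) \<in> inv_con M \<pi> \<psi>" using uv by (simp add: inv_con_def)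
    then show "(u, v) \<in> \<psi>'" using * xy by (auto simp: inv_con_def)
  qed
qed (rule inv_con_mono)

lemma inv_con_inj: "inj_on (inv_con M \<pi>) (Pow (carr N \<times> carr N))"
proof (rule inj_onI)
  fix \<psi> \<psi>' assume *: "\<psi> \<in> Pow (carr N \<times> carr N)" "\<psi>' \<in> Pow (carr N \<times> carr N)"
    "inv_con M \<pi> \<psi> = inv_con M \<pi> \<psi>'"
  then show "\<psi> = \<psi>'" using inv_con_le_iff[of \<psi> \<psi>'] inv_con_le_iff[of \<psi>' \<psi>] by auto
qed

lemma Ker_le_inv_con: "\<psi> \<in> Con \<sigma> N \<Longrightarrow> Ker M N \<pi> \<subseteq> inv_con M \<pi> \<psi>"
  unfolding Ker_def by (rule inv_con_mono) (auto simp: Delta_def dest: ConD(2))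

text \<open>Half of the correspondence theorem: \<open>\<psi>\<close> is the image of
  \<open>\<gamma>\<close>. As \<open>\<gamma>\<close> contains the kernel, membership in the image
  does not depend on the chosen preimages; the same fact glues two pairs together for
  transitivity.\<close>

lemma Con_above_Ker:
  assumes \<gamma>: "\<gamma> \<in> Con \<sigma> M" and ker: "Ker M N \<pi> \<subseteq> \<gamma>"
  obtains \<psi> where "\<psi> \<in> Con \<sigma> N" "inv_con M \<pi> \<psi> = \<gamma>"
proof
  have lift: "(x, y) \<in> \<gamma>" if "x \<in> carr M" "y \<in> carr M" "\<pi> x = \<pi> y" for x y
  proof -
    have "\<pi> y \<in> carr N" using imageI[OF that(2), of \<pi>] surj by simp
    then have "(x, y) \<in> Ker M N \<pi>" using that by (simp add: Ker_def inv_con_def Delta_def Id_on_iff)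
    then show ?thesis using ker by blast
  qed
  note sub = ConD(1)[OF \<gamma>]
  let ?\<psi> = "map_prod \<pi> \<pi> ` \<gamma>"
  have mem: "(u, v) \<in> ?\<psi> \<longleftrightarrow> (\<exists>p. p \<in> \<gamma> \<and> u = \<pi> (fst p) \<and> v = \<pi> (snd p))" for u v
    by force
  have tr: "(x, z) \<in> \<gamma>" if "(x, y) \<in> \<gamma>" "(y, z) \<in> \<gamma>" for x y z
    using transD[OF ConD(4)[OF \<gamma>] that] .
  have iff: "(\<pi> x, \<pi> y) \<in> ?\<psi> \<longleftrightarrow> (x, y) \<in> \<gamma>" if xy: "x \<in> carr M" "y \<in> carr M" for x y
  proof
    assume "(\<pi> x, \<pi> y) \<in> ?\<psi>"
    then obtain x' y' where p: "(x', y') \<in> \<gamma>" "\<pi> x = \<pi> x'" "\<pi> y = \<pi> y'" by auto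
    moreover have "x' \<in> carr M" "y' \<in> carr M" using p(1) sub by blast+
    ultimately have "(x, x') \<in> \<gamma>" "(y', y) \<in> \<gamma>" using lift xy by simp_all
    then show "(x, y) \<in> \<gamma>" using tr p(1) by blast
  qed force
  show "inv_con M \<pi> ?\<psi> = \<gamma>" using iff sub by (fastforce simp: inv_con_def)
  show "?\<psi> \<in> Con \<sigma> N"
  proof (rule ConI)
    show "?\<psi> \<subseteq> carr N \<times> carr N" using sub surj by auto
    show "(u, u) \<in> ?\<psi>" if "u \<in> carr N" for u
    proof -
      obtain x where "x \<in> carr M" "u = \<pi> x" using inv_into_surj[OF \<open>u \<in> carr N\<close>] by metis
      then show ?thesis using iff ConD(2)[OF \<gamma>] by blast
    qed
    show "sym ?\<psi>"
    proof (rule symI)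
      fix u v assume "(u, v) \<in> ?\<psi>"
      then obtain x y where "(x, y) \<in> \<gamma>" "u = \<pi> x" "v = \<pi> y" by auto
      then show "(v, u) \<in> ?\<psi>" using symD[OF ConD(3)[OF \<gamma>]] by force
    qed
    show "trans ?\<psi>"
    proof (rule transI)
      fix u v w assume "(u, v) \<in> ?\<psi>" "(v, w) \<in> ?\<psi>"
      then obtain x y y' z where *: "(x, y) \<in> \<gamma>" "(y', z) \<in> \<gamma>" "u = \<pi> x" "v = \<pi> y" "v = \<pi> y'" "w = \<pi> z"
        by auto
      moreover have "y \<in> carr M" "y' \<in> carr M" using *(1,2) sub by blast+
      ultimately have "(y, y') \<in> \<gamma>" using lift by simp
      then have "(x, z) \<in> \<gamma>" using tr * by blast
      then show "(u, w) \<in> ?\<psi>" using * by force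
    qed
    show "(oper N f us, oper N f vs) \<in> ?\<psi>"
      if f: "\<sigma> f = Some (length us)" and l: "list_all2 (\<lambda>x y. (x, y) \<in> ?\<psi>) us vs" for f us vs
    proof -
      \<comment> \<open>A single list of pairs from \<open>\<gamma>\<close> supplies matching
        preimages of both argument lists.\<close>
      obtain ps where ps: "\<forall>p\<in>set ps. p \<in> \<gamma>" "us = map (\<lambda>p. \<pi> (fst p)) ps" "vs = map (\<lambda>p. \<pi> (snd p)) ps"
        using list_all2_common_preimage[OF l[unfolded mem]] by blast
      have len: "\<sigma> f = Some (length (map fst ps))" "\<sigma> f = Some (length (map snd ps))"
        using f ps(2) by simp_all
      have "list_all2 (\<lambda>x y. (x, y) \<in> \<gamma>) (map fst ps) (map snd ps)"
        using ps(1) by (auto simp: list_all2_map1 list_all2_map2 list_all2_same)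
      then have "(oper M f (map fst ps), oper M f (map snd ps)) \<in> \<gamma>"
        by (rule ConD(5)[OF \<gamma> len(1)])
      moreover have "set (map fst ps) \<subseteq> carr M" "set (map snd ps) \<subseteq> carr M"
        using ps(1) sub by fastforce+
      then have "\<pi> (oper M f (map fst ps)) = oper N f us" "\<pi> (oper M f (map snd ps)) = oper N f vs"
        using mor len ps(2,3) unfolding morphism_def by (simp_all add: comp_def)
      ultimately show ?thesis by force
    qed
  qed
qed

text \<open>The forward implication lifts the four sequences through \<open>\<pi>\<close>, which
  surjectivity allows.\<close>

lemma term_condition_inv_con:
  assumes \<alpha>: "\<alpha> \<subseteq> carr N \<times> carr N" and \<beta>: "\<beta> \<subseteq> carr N \<times> carr N"
  shows "term_condition \<sigma> M (inv_con M \<pi> \<alpha>) (inv_con M \<pi> \<beta>) (inv_con M \<pi> \<psi>)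
    \<longleftrightarrow> term_condition \<sigma> N \<alpha> \<beta> \<psi>" (is "?L \<longleftrightarrow> ?R")
proof
  have carr: "eval_trm M (case_sum a c) t \<in> carr M"
    if "wf_trm \<sigma> t" "range a \<subseteq> carr M" "range c \<subseteq> carr M" for a c and t :: "('f, nat + nat) trm"
    using that by (intro eval_in_carr[OF algM]) (auto simp: image_subset_iff split: sum.split)
  note ev = morphism_eval_case_sum[OF algM mor]
  show ?L if ?R by (rule term_condition_pullback[OF algM mor that])
  show ?R if L: ?L
    unfolding term_condition_def
  proof (intro allI impI, elim conjE)
    fix t :: "('f, nat + nat) trm" and a b c d
    assume t: "wf_trm \<sigma> t" and *: "\<forall>i. (a i, b i) \<in> \<alpha>" "\<forall>j. (c j, d j) \<in> \<beta>"
      and row: "(eval_trm N (case_sum a c) t, eval_trm N (case_sum a d) t) \<in> \<psi>"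
    have "range a \<subseteq> carr N" "range b \<subseteq> carr N" "range c \<subseteq> carr N" "range d \<subseteq> carr N"
      using * \<alpha> \<beta> by blast+
    then obtain a' b' c' d' where r: "range a' \<subseteq> carr M" "range b' \<subseteq> carr M" "range c' \<subseteq> carr M"
        "range d' \<subseteq> carr M" and e: "a = \<pi> \<circ> a'" "b = \<pi> \<circ> b'" "c = \<pi> \<circ> c'" "d = \<pi> \<circ> d'"
      by (metis lift_seq)
    have "\<forall>i. (a' i, b' i) \<in> inv_con M \<pi> \<alpha>" "\<forall>j. (c' j, d' j) \<in> inv_con M \<pi> \<beta>"
      using * r e by (auto simp: inv_con_def)
    moreover have "(eval_trm M (case_sum a' c') t, eval_trm M (case_sum a' d') t) \<in> inv_con M \<pi> \<psi>"
      using row e ev[OF t] carr[OF t] r by (simp add: inv_con_def)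
    ultimately have "(eval_trm M (case_sum b' c') t, eval_trm M (case_sum b' d') t) \<in> inv_con M \<pi> \<psi>"
      using L t unfolding term_condition_def by blast
    then show "(eval_trm N (case_sum b c) t, eval_trm N (case_sum b d) t) \<in> \<psi>"
      using e ev[OF t] r by (simp add: inv_con_def)
  qed
qed

end

section \<open>Projections onto quotients and the spectra of quotients\<close>

lemma quotient_surjective_morphism:
  assumes M: "is_alg \<sigma> M" and \<theta>: "\<theta> \<in> Con \<sigma> M"
  shows "surjective_morphism \<sigma> M (quot_alg M \<theta>) (\<lambda>x. \<theta> `` {x})"
proof
  show "is_alg \<sigma> M" by fact
  show "(\<lambda>x. \<theta> `` {x}) ` carr M = carr (quot_alg M \<theta>)"
    by (auto simp: quot_alg_def quotient_def)
  then show "morphism \<sigma> M (quot_alg M \<theta>) (\<lambda>x. \<theta> `` {x})"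
    using quot_oper[OF M \<theta>] by (auto simp: morphism_def)
qed

lemma Ker_quotient:
  assumes "\<theta> \<in> Con \<sigma> M"
  shows "Ker M (quot_alg M \<theta>) (\<lambda>x. \<theta> `` {x}) = \<theta>"
proof -
  have eq: "equiv (carr M) \<theta>" using assms by (simp add: Con_def)
  show ?thesis
    using eq_equiv_class_iff[OF eq] ConD(1)[OF assms]
    by (auto simp: Ker_def inv_con_def Delta_def quot_alg_def Id_on_iff intro: quotientI)
qed

context modular_class
begin

text \<open>By \<open>Spec_iff\<close> only congruences above \<open>inv_con M \<pi> \<psi>\<close>
  have to be tested. They contain the kernel, so each of them is the pullback of a congruence of
  \<open>N\<close>.\<close>

lemma Spec_surjective:
  assumes "surjective_morphism \<sigma> M N \<pi>" and M: "in_class \<sigma> E M" and \<psi>: "\<psi> \<in> Con \<sigma> N"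
  shows "inv_con M \<pi> \<psi> \<in> Spec \<sigma> M \<longleftrightarrow> \<psi> \<in> Spec \<sigma> N"
proof -
  interpret surjective_morphism \<sigma> M N \<pi> by fact
  have N: "in_class \<sigma> E N" by (rule in_class_image[OF M wf])
  have con: "inv_con M \<pi> \<theta> \<in> Con \<sigma> M" if "\<theta> \<in> Con \<sigma> N" for \<theta>
    by (rule inv_con_Con[OF algM mor that])
  have "inv_con M \<pi> (Nabla N) = Nabla M"
    unfolding inv_con_def Nabla_def surj[symmetric] by auto
  then have ne: "inv_con M \<pi> \<psi> = Nabla M \<longleftrightarrow> \<psi> = Nabla N"
    using inj_on_eq_iff[OF inv_con_inj, of \<psi> "Nabla N"] ConD(1)[OF \<psi>] by (auto simp: Nabla_def)
  have le: "inv_con M \<pi> \<theta> \<subseteq> inv_con M \<pi> \<theta>' \<longleftrightarrow> \<theta> \<subseteq> \<theta>'" if "\<theta> \<in> Con \<sigma> N" for \<theta> \<theta>'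
    by (rule inv_con_le_iff[OF ConD(1)[OF that]])
  have tc: "term_condition \<sigma> M (inv_con M \<pi> \<alpha>) (inv_con M \<pi> \<beta>) (inv_con M \<pi> \<psi>)
      \<longleftrightarrow> term_condition \<sigma> N \<alpha> \<beta> \<psi>" if "\<alpha> \<in> Con \<sigma> N" "\<beta> \<in> Con \<sigma> N" for \<alpha> \<beta>
    by (rule term_condition_inv_con[OF ConD(1)[OF that(1)] ConD(1)[OF that(2)]])
  have above: "\<exists>\<alpha>'\<in>Con \<sigma> N. inv_con M \<pi> \<alpha>' = \<alpha>" if "\<alpha> \<in> Con \<sigma> M" "inv_con M \<pi> \<psi> \<subseteq> \<alpha>" for \<alpha>
    using Con_above_Ker[OF that(1)] Ker_le_inv_con[OF \<psi>] that(2) by (metis order_trans)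
  show ?thesis
  proof
    assume L: "inv_con M \<pi> \<psi> \<in> Spec \<sigma> M"
    have "\<alpha> \<subseteq> \<psi> \<or> \<beta> \<subseteq> \<psi>"
      if *: "\<alpha> \<in> Con \<sigma> N" "\<beta> \<in> Con \<sigma> N" "\<psi> \<subseteq> \<alpha>" "\<psi> \<subseteq> \<beta>" "term_condition \<sigma> N \<alpha> \<beta> \<psi>" for \<alpha> \<beta>
    proof -
      have "inv_con M \<pi> \<alpha> \<subseteq> inv_con M \<pi> \<psi> \<or> inv_con M \<pi> \<beta> \<subseteq> inv_con M \<pi> \<psi>"
        using L con[OF *(1)] con[OF *(2)] inv_con_mono[OF *(3), of M \<pi>] inv_con_mono[OF *(4), of M \<pi>]
          iffD2[OF tc[OF *(1,2)] *(5)] unfolding Spec_iff[OF M] by blast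
      then show ?thesis using le[OF *(1)] le[OF *(2)] by simp
    qed
    moreover have "\<psi> \<noteq> Nabla N" using L ne unfolding Spec_iff[OF M] by blast
    ultimately show "\<psi> \<in> Spec \<sigma> N" using \<psi> unfolding Spec_iff[OF N] by blast
  next
    assume R: "\<psi> \<in> Spec \<sigma> N"
    have "\<alpha> \<subseteq> inv_con M \<pi> \<psi> \<or> \<beta> \<subseteq> inv_con M \<pi> \<psi>"
      if *: "\<alpha> \<in> Con \<sigma> M" "\<beta> \<in> Con \<sigma> M" "inv_con M \<pi> \<psi> \<subseteq> \<alpha>" "inv_con M \<pi> \<psi> \<subseteq> \<beta>"
        "term_condition \<sigma> M \<alpha> \<beta> (inv_con M \<pi> \<psi>)" for \<alpha> \<beta>
    proof -
      obtain \<alpha>' where a: "\<alpha>' \<in> Con \<sigma> N" "inv_con M \<pi> \<alpha>' = \<alpha>" using above[OF *(1,3)] by blast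
      obtain \<beta>' where b: "\<beta>' \<in> Con \<sigma> N" "inv_con M \<pi> \<beta>' = \<beta>" using above[OF *(2,4)] by blast
      have "\<psi> \<subseteq> \<alpha>'" "\<psi> \<subseteq> \<beta>'" "term_condition \<sigma> N \<alpha>' \<beta>' \<psi>"
        using *(3-5) le[OF \<psi>] tc[OF a(1) b(1)] unfolding a(2) b(2)
        by (simp_all add: a(2)[symmetric] b(2)[symmetric])
      then have "\<alpha>' \<subseteq> \<psi> \<or> \<beta>' \<subseteq> \<psi>" using R a(1) b(1) unfolding Spec_iff[OF N] by blast
      then show ?thesis unfolding a(2)[symmetric] b(2)[symmetric] le[OF a(1)] le[OF b(1)] .
    qed
    moreover have "inv_con M \<pi> \<psi> \<noteq> Nabla M" using R ne unfolding Spec_iff[OF N] by blast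
    ultimately show "inv_con M \<pi> \<psi> \<in> Spec \<sigma> M"
      using con[OF \<psi>] unfolding Spec_iff[OF M] by blast
  qed
qed

text \<open>Used for the quotients of both \<open>A\<close> and \<open>B\<close>, it turns
  statements about an induced morphism into statements about closed sets of the two original
  spectra.\<close>

lemma inv_con_Spec_quotient:
  assumes M: "in_class \<sigma> E M" and \<theta>: "\<theta> \<in> Con \<sigma> M"
  shows "inv_con M (\<lambda>x. \<theta> `` {x}) ` Spec \<sigma> (quot_alg M \<theta>) = Vset \<sigma> M \<theta>"
proof -
  have alg: "is_alg \<sigma> M" using M by (simp add: in_class_def)
  note sm = quotient_surjective_morphism[OF alg \<theta>]
  interpret surjective_morphism \<sigma> M "quot_alg M \<theta>" "\<lambda>x. \<theta> `` {x}" by (rule sm)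
  have con: "\<psi> \<in> Con \<sigma> (quot_alg M \<theta>)" if "\<psi> \<in> Spec \<sigma> (quot_alg M \<theta>)" for \<psi>
    using that by (simp add: Spec_def)
  show ?thesis
  proof (intro equalityI subsetI)
    fix \<phi> assume "\<phi> \<in> inv_con M (\<lambda>x. \<theta> `` {x}) ` Spec \<sigma> (quot_alg M \<theta>)"
    then show "\<phi> \<in> Vset \<sigma> M \<theta>"
      using Spec_surjective[OF sm M con] Ker_le_inv_con[OF con]
      unfolding Ker_quotient[OF \<theta>] by (auto simp: Vset_def)
  next
    fix \<phi> assume "\<phi> \<in> Vset \<sigma> M \<theta>"
    then have \<phi>: "\<phi> \<in> Spec \<sigma> M" "\<phi> \<in> Con \<sigma> M" "Ker M (quot_alg M \<theta>) (\<lambda>x. \<theta> `` {x}) \<subseteq> \<phi>"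
      unfolding Ker_quotient[OF \<theta>] by (auto simp: Vset_def Spec_def)
    then obtain \<psi> where "\<psi> \<in> Con \<sigma> (quot_alg M \<theta>)" "inv_con M (\<lambda>x. \<theta> `` {x}) \<psi> = \<phi>"
      using Con_above_Ker by blast
    then show "\<phi> \<in> inv_con M (\<lambda>x. \<theta> `` {x}) ` Spec \<sigma> (quot_alg M \<theta>)"
      using Spec_surjective[OF sm M] \<phi>(1) by blast
  qed
qed

end


section \<open>Going Up and Lying Over\<close>

text \<open>Operations are finitary, so the finitely many pairs of arguments all lie in one member
  of the chain.\<close>

lemma Union_chain_Con:
  assumes "C \<noteq> {}" and C: "subset.chain (Con \<sigma> M) C"
  shows "\<Union>C \<in> Con \<sigma> M"
proof (rule ConI)
  have con: "\<theta> \<in> Con \<sigma> M" if "\<theta> \<in> C" for \<theta> using C that by (auto simp: subset.chain_def)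
  have two: "\<exists>\<theta>\<in>C. p \<in> \<theta> \<and> q \<in> \<theta>" if pq: "p \<in> \<Union>C" "q \<in> \<Union>C" for p q
  proof -
    obtain \<theta> \<theta>' where *: "\<theta> \<in> C" "p \<in> \<theta>" "\<theta>' \<in> C" "q \<in> \<theta>'" using pq by blast
    then have "\<theta> \<subseteq> \<theta>' \<or> \<theta>' \<subseteq> \<theta>" using C by (simp add: subset_chain_def)
    with * show ?thesis by blast
  qed
  show "\<Union>C \<subseteq> carr M \<times> carr M" by (rule Union_least) (rule ConD(1)[OF con])
  show "(x, x) \<in> \<Union>C" if x: "x \<in> carr M" for x
  proof -
    obtain \<theta> where \<theta>: "\<theta> \<in> C" using assms(1) by blast
    then show ?thesis using ConD(2)[OF con[OF \<theta>] x] by blast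
  qed
  show "sym (\<Union>C)"
  proof (rule symI)
    fix x y assume "(x, y) \<in> \<Union>C"
    then obtain \<theta> where \<theta>: "\<theta> \<in> C" "(x, y) \<in> \<theta>" by blast
    then show "(y, x) \<in> \<Union>C" using symD[OF ConD(3)[OF con[OF \<theta>(1)]] \<theta>(2)] by blast
  qed
  show "trans (\<Union>C)"
  proof (rule transI)
    fix x y z assume "(x, y) \<in> \<Union>C" "(y, z) \<in> \<Union>C"
    then obtain \<theta> where \<theta>: "\<theta> \<in> C" "(x, y) \<in> \<theta>" "(y, z) \<in> \<theta>" using two by blast
    then show "(x, z) \<in> \<Union>C" using transD[OF ConD(4)[OF con[OF \<theta>(1)]] \<theta>(2,3)] by blast
  qed
  show "(oper M f xs, oper M f ys) \<in> \<Union>C"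
    if f: "\<sigma> f = Some (length xs)" and l: "list_all2 (\<lambda>x y. (x, y) \<in> \<Union>C) xs ys" for f xs ys
  proof -
    have "\<exists>\<theta>\<in>C. list_all2 (\<lambda>x y. (x, y) \<in> \<theta>) xs ys"
      using l
    proof (induction rule: list_all2_induct)
      case Nil
      then show ?case using assms(1) by auto
    next
      case (Cons x xs y ys)
      then obtain \<theta> \<theta>' where \<theta>: "\<theta> \<in> C" "(x, y) \<in> \<theta>" "\<theta>' \<in> C" "list_all2 (\<lambda>x y. (x, y) \<in> \<theta>') xs ys"
        by blast
      then have "\<theta> \<subseteq> \<theta>' \<or> \<theta>' \<subseteq> \<theta>" using C by (simp add: subset_chain_def)
      then show ?case
      proof
        assume "\<theta> \<subseteq> \<theta>'"
        then have "list_all2 (\<lambda>x y. (x, y) \<in> \<theta>') (x # xs) (y # ys)" using \<theta> by auto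
        then show ?thesis using \<theta>(3) by blast
      next
        assume "\<theta>' \<subseteq> \<theta>"
        then have "list_all2 (\<lambda>x y. (x, y) \<in> \<theta>) xs ys"
          by (intro list_all2_mono[OF \<theta>(4)]) blast
        then have "list_all2 (\<lambda>x y. (x, y) \<in> \<theta>) (x # xs) (y # ys)" using \<theta> by auto
        then show ?thesis using \<theta>(1) by blast
      qed
    qed
    then obtain \<theta> where \<theta>: "\<theta> \<in> C" "list_all2 (\<lambda>x y. (x, y) \<in> \<theta>) xs ys" by blast
    then show ?thesis using ConD(5)[OF con[OF \<theta>(1)] f \<theta>(2)] by blast
  qed
qed

section \<open>Primes along an admissible morphism, and Going Up in terms of closed sets\<close>

locale admissible_morphism = modular_class \<sigma> E for \<sigma> :: "'f signat" and E :: "'f identities" +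
  fixes A :: "('f, 'a) alg" and B :: "('f, 'b) alg" and f :: "'a \<Rightarrow> 'b"
  assumes A: "in_class \<sigma> E A" and B: "in_class \<sigma> E B" and f: "morphism \<sigma> A B f"
    and adm: "admissible_mor \<sigma> A B f"
begin

lemma alg: "is_alg \<sigma> A" "is_alg \<sigma> B"
  using A B by (simp_all add: in_class_def)

lemma inv_con_f: "\<beta> \<in> Con \<sigma> B \<Longrightarrow> inv_con A f \<beta> \<in> Con \<sigma> A"
  by (rule inv_con_Con[OF alg(1) f])

text \<open>A congruence \<open>\<gamma>\<close> maximal with \<open>f\<^sup>*(\<gamma>) \<subseteq> \<phi>\<close> is prime: if \<open>[\<alpha>, \<beta>] \<subseteq> \<gamma>\<close> with \<open>\<alpha>\<close>, \<open>\<beta>\<close>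
  strictly above \<open>\<gamma>\<close>, then \<open>[f\<^sup>*(\<alpha>), f\<^sup>*(\<beta>)] \<subseteq> f\<^sup>*(\<gamma>) \<subseteq> \<phi>\<close>, although neither factor lies below \<open>\<phi>\<close>.\<close>

lemma prime_above:
  assumes \<theta>: "\<theta> \<in> Con \<sigma> B" and \<phi>: "\<phi> \<in> Spec \<sigma> A" and le: "inv_con A f \<theta> \<subseteq> \<phi>"
  obtains \<gamma> where "\<gamma> \<in> Spec \<sigma> B" "\<theta> \<subseteq> \<gamma>" "inv_con A f \<gamma> \<subseteq> \<phi>"
proof -
  define S where "S = {\<gamma> \<in> Con \<sigma> B. \<theta> \<subseteq> \<gamma> \<and> inv_con A f \<gamma> \<subseteq> \<phi>}"
  have "\<Union>C \<in> S" if C: "C \<noteq> {}" "subset.chain S C" for C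
  proof -
    have sub: "C \<subseteq> S" using C(2) by (simp add: subset_chain_def)
    have "subset.chain (Con \<sigma> B) C" using C(2) by (auto simp: subset_chain_def S_def)
    then have "\<Union>C \<in> Con \<sigma> B" by (rule Union_chain_Con[OF C(1)])
    moreover have "\<theta> \<subseteq> \<Union>C" using C(1) sub by (auto simp: S_def)
    moreover have "inv_con A f (\<Union>C) \<subseteq> \<phi>" using sub by (fastforce simp: S_def inv_con_def)
    ultimately show ?thesis by (simp add: S_def)
  qed
  moreover have "S \<noteq> {}" using \<theta> le by (auto simp: S_def)
  ultimately obtain \<gamma> where \<gamma>: "\<gamma> \<in> S" and max: "\<And>\<alpha>. \<alpha> \<in> S \<Longrightarrow> \<gamma> \<subseteq> \<alpha> \<Longrightarrow> \<alpha> = \<gamma>"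
    using subset_Zorn_nonempty[of S] by metis
  have \<gamma>': "\<gamma> \<in> Con \<sigma> B" "\<theta> \<subseteq> \<gamma>" "inv_con A f \<gamma> \<subseteq> \<phi>" using \<gamma> by (simp_all add: S_def)
  \<comment> \<open>Maximality in usable form: a congruence strictly above \<open>\<gamma>\<close>
    has a pullback that is not below \<open>\<phi>\<close>.\<close>
  have small: "\<alpha> \<subseteq> \<gamma>" if "\<alpha> \<in> Con \<sigma> B" "\<gamma> \<subseteq> \<alpha>" "inv_con A f \<alpha> \<subseteq> \<phi>" for \<alpha>
    using max[of \<alpha>] that \<gamma>'(2) by (auto simp: S_def)
  have "\<gamma> \<noteq> Nabla B"
  proof
    assume "\<gamma> = Nabla B"
    then have "inv_con A f \<gamma> = Nabla A" using f by (auto simp: inv_con_def Nabla_def morphism_def)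
    moreover have "\<phi> \<in> Con \<sigma> A" "\<phi> \<noteq> Nabla A" using \<phi> by (simp_all add: Spec_def)
    ultimately show False using \<gamma>'(3) ConD(1)[of \<phi> \<sigma> A] by (simp add: Nabla_def)
  qed
  moreover have "\<alpha> \<subseteq> \<gamma> \<or> \<beta> \<subseteq> \<gamma>"
    if *: "\<alpha> \<in> Con \<sigma> B" "\<beta> \<in> Con \<sigma> B" "\<gamma> \<subseteq> \<alpha>" "\<gamma> \<subseteq> \<beta>" "term_condition \<sigma> B \<alpha> \<beta> \<gamma>" for \<alpha> \<beta>
  proof -
    have "term_condition \<sigma> A (inv_con A f \<alpha>) (inv_con A f \<beta>) (inv_con A f \<gamma>)"
      by (rule term_condition_pullback[OF alg(1) f *(5)])
    then have "commutator \<sigma> A (inv_con A f \<alpha>) (inv_con A f \<beta>) \<subseteq> inv_con A f \<gamma>"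
      by (rule commutator_least(3)[OF inv_con_f[OF *(1)] inv_con_f[OF *(2)] inv_con_f[OF \<gamma>'(1)]])
    then have "commutator \<sigma> A (inv_con A f \<alpha>) (inv_con A f \<beta>) \<subseteq> \<phi>" using \<gamma>'(3) by (rule subset_trans)
    then have "inv_con A f \<alpha> \<subseteq> \<phi> \<or> inv_con A f \<beta> \<subseteq> \<phi>"
      using \<phi> inv_con_f[OF *(1)] inv_con_f[OF *(2)] by (simp add: Spec_def)
    then show ?thesis using small * by blast
  qed
  ultimately have "\<gamma> \<in> Spec \<sigma> B" using \<gamma>'(1) unfolding Spec_iff[OF B] by blast
  then show ?thesis using that \<gamma>' by blast
qed

text \<open>The common form to which all conditions are reduced. Admissibility makes the pullback of
  \<open>\<phi>\<close> a prime, as the definition of \<open>GU\<close> requires of its lower prime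
  in \<open>A\<close>.\<close>

lemma GU_iff: "GU \<sigma> A B f \<longleftrightarrow> (\<forall>\<phi>\<in>Spec \<sigma> B. Vset \<sigma> A (inv_con A f \<phi>) \<subseteq> inv_con A f ` Vset \<sigma> B \<phi>)"
  (is "_ \<longleftrightarrow> ?R")
proof
  assume G: "GU \<sigma> A B f"
  show ?R
  proof (intro ballI subsetI)
    fix \<phi> \<psi> assume \<phi>: "\<phi> \<in> Spec \<sigma> B" and \<psi>: "\<psi> \<in> Vset \<sigma> A (inv_con A f \<phi>)"
    have "inv_con A f \<phi> \<in> Spec \<sigma> A" using adm \<phi> by (simp add: admissible_mor_def)
    then obtain \<psi>\<^sub>1 where "\<psi>\<^sub>1 \<in> Spec \<sigma> B" "\<phi> \<subseteq> \<psi>\<^sub>1" "inv_con A f \<psi>\<^sub>1 = \<psi>"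
      using G \<phi> \<psi> unfolding GU_def Vset_def by blast
    then show "\<psi> \<in> inv_con A f ` Vset \<sigma> B \<phi>" by (auto simp: Vset_def)
  qed
next
  assume R: ?R
  show "GU \<sigma> A B f"
    unfolding GU_def
  proof (intro ballI impI, elim conjE)
    fix \<phi> \<psi> \<phi>\<^sub>1
    assume "\<psi> \<in> Spec \<sigma> A" "\<phi>\<^sub>1 \<in> Spec \<sigma> B" "\<phi> \<subseteq> \<psi>" "inv_con A f \<phi>\<^sub>1 = \<phi>"
    then have "\<psi> \<in> inv_con A f ` Vset \<sigma> B \<phi>\<^sub>1" using R by (auto simp: Vset_def)
    then show "\<exists>\<psi>\<^sub>1\<in>Spec \<sigma> B. \<phi>\<^sub>1 \<subseteq> \<psi>\<^sub>1 \<and> inv_con A f \<psi>\<^sub>1 = \<psi>" by (auto simp: Vset_def)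
  qed
qed

text \<open>Extends the inclusion from primes to all congruences: \<open>prime_above\<close>
  replaces \<open>\<beta>\<close> by a prime \<open>\<gamma>\<close> above it whose pullback is
  still below \<open>\<phi>\<close>, and \<open>GU_iff\<close> applies to
  \<open>\<gamma>\<close>.\<close>

lemma Vset_le_of_GU:
  assumes "GU \<sigma> A B f" and \<beta>: "\<beta> \<in> Con \<sigma> B"
  shows "Vset \<sigma> A (inv_con A f \<beta>) \<subseteq> inv_con A f ` Vset \<sigma> B \<beta>"
proof
  fix \<phi> assume "\<phi> \<in> Vset \<sigma> A (inv_con A f \<beta>)"
  then have \<phi>: "\<phi> \<in> Spec \<sigma> A" "inv_con A f \<beta> \<subseteq> \<phi>" by (simp_all add: Vset_def)
  obtain \<gamma> where \<gamma>: "\<gamma> \<in> Spec \<sigma> B" "\<beta> \<subseteq> \<gamma>" "inv_con A f \<gamma> \<subseteq> \<phi>"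
    using prime_above[OF \<beta> \<phi>] .
  have "\<phi> \<in> Vset \<sigma> A (inv_con A f \<gamma>)" using \<phi>(1) \<gamma>(3) by (simp add: Vset_def)
  then have "\<phi> \<in> inv_con A f ` Vset \<sigma> B \<gamma>" using assms(1) \<gamma>(1) unfolding GU_iff by blast
  then show "\<phi> \<in> inv_con A f ` Vset \<sigma> B \<beta>" using \<gamma>(2) by (auto simp: Vset_def)
qed

lemma inv_con_Vset_le: "inv_con A f ` Vset \<sigma> B \<beta> \<subseteq> Vset \<sigma> A (inv_con A f \<beta>)"
proof clarify
  fix \<psi> assume "\<psi> \<in> Vset \<sigma> B \<beta>"
  then have "inv_con A f \<psi> \<in> Spec \<sigma> A" "inv_con A f \<beta> \<subseteq> inv_con A f \<psi>"
    using adm inv_con_mono[of \<beta> \<psi>] by (simp_all add: Vset_def admissible_mor_def)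
  then show "inv_con A f \<psi> \<in> Vset \<sigma> A (inv_con A f \<beta>)" by (simp add: Vset_def)
qed

text \<open>If the image of \<open>Vset \<sigma> B \<phi>\<close> is closed, it contains every prime
  above its member \<open>inv_con A f \<phi>\<close>, which is the criterion of
  \<open>GU_iff\<close>. Conversely, Going Up makes the image of the closed set of
  \<open>\<beta>\<close> equal to that of \<open>inv_con A f \<beta>\<close>.\<close>

lemma closed_map_iff_GU: "closed_map (stone \<sigma> B) (stone \<sigma> A) (inv_con A f) \<longleftrightarrow> GU \<sigma> A B f"
proof
  assume cl: "closed_map (stone \<sigma> B) (stone \<sigma> A) (inv_con A f)"
  show "GU \<sigma> A B f"
    unfolding GU_iff
  proof (intro ballI subsetI)
    fix \<phi> \<psi> assume \<phi>: "\<phi> \<in> Spec \<sigma> B" and \<psi>: "\<psi> \<in> Vset \<sigma> A (inv_con A f \<phi>)"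
    have "closedin (stone \<sigma> B) (Vset \<sigma> B \<phi>)"
      using \<phi> unfolding closedin_stone(1)[OF alg(2)] Spec_def by blast
    then have "closedin (stone \<sigma> A) (inv_con A f ` Vset \<sigma> B \<phi>)"
      using cl by (simp add: closed_map_def)
    then obtain \<theta> where \<theta>: "inv_con A f ` Vset \<sigma> B \<phi> = Vset \<sigma> A \<theta>"
      unfolding closedin_stone(1)[OF alg(1)] by blast
    have "\<phi> \<in> Vset \<sigma> B \<phi>" using \<phi> by (simp add: Vset_def)
    then have "inv_con A f \<phi> \<in> Vset \<sigma> A \<theta>" unfolding \<theta>[symmetric] by (rule imageI)
    then show "\<psi> \<in> inv_con A f ` Vset \<sigma> B \<phi>"
      unfolding \<theta> using \<psi> by (auto simp: Vset_def)
  qed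
next
  assume G: "GU \<sigma> A B f"
  show "closed_map (stone \<sigma> B) (stone \<sigma> A) (inv_con A f)"
    unfolding closed_map_def
  proof (intro allI impI)
    fix U assume "closedin (stone \<sigma> B) U"
    then obtain \<beta> where \<beta>: "\<beta> \<in> Con \<sigma> B" "U = Vset \<sigma> B \<beta>"
      unfolding closedin_stone(1)[OF alg(2)] by blast
    have "inv_con A f ` U = Vset \<sigma> A (inv_con A f \<beta>)"
      unfolding \<beta>(2) using inv_con_Vset_le Vset_le_of_GU[OF G \<beta>(1)] by (rule equalityI)
    then show "closedin (stone \<sigma> A) (inv_con A f ` U)"
      unfolding closedin_stone(1)[OF alg(1)] using inv_con_f[OF \<beta>(1)] by blast
  qed
qed

section \<open>The induced morphism between quotients, for a fixed congruence of
  \<open>B\<close>\<close>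

context
  fixes \<beta> assumes \<beta>: "\<beta> \<in> Con \<sigma> B"
begin

abbreviation "A\<beta> \<equiv> quot_alg A (inv_con A f \<beta>)"
abbreviation "B\<beta> \<equiv> quot_alg B \<beta>"
abbreviation "f\<beta> \<equiv> induced f \<beta>"
abbreviation "pull_A \<equiv> inv_con A (\<lambda>x. inv_con A f \<beta> `` {x})"
abbreviation "pull_B \<equiv> inv_con B (\<lambda>x. \<beta> `` {x})"

interpretation qA: surjective_morphism \<sigma> A A\<beta> "\<lambda>x. inv_con A f \<beta> `` {x}"
  by (rule quotient_surjective_morphism[OF alg(1) inv_con_f[OF \<beta>]])

interpretation qB: surjective_morphism \<sigma> B B\<beta> "\<lambda>x. \<beta> `` {x}"
  by (rule quotient_surjective_morphism[OF alg(2) \<beta>])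

lemma Spec_A: "pull_A ` Spec \<sigma> A\<beta> = Vset \<sigma> A (inv_con A f \<beta>)"
  by (rule inv_con_Spec_quotient[OF A inv_con_f[OF \<beta>]])

lemma Spec_B: "pull_B ` Spec \<sigma> B\<beta> = Vset \<sigma> B \<beta>"
  by (rule inv_con_Spec_quotient[OF B \<beta>])

text \<open>The square formed by \<open>f\<close>, \<open>f\<beta>\<close> and the two projections
  commutes, by \<open>induced_class\<close>.\<close>

lemma pull_induced: "pull_A (inv_con A\<beta> f\<beta> \<chi>) = inv_con A f (pull_B \<chi>)"
proof -
  have "f x \<in> carr B" if "x \<in> carr A" for x using f that by (auto simp: morphism_def)
  moreover have "inv_con A f \<beta> `` {x} \<in> carr A\<beta>" if "x \<in> carr A" for x
    using that by (auto simp: quot_alg_def intro: quotientI)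
  ultimately show ?thesis
    using induced_class[OF f \<beta>] by (auto simp: inv_con_def[of _ f\<beta>] inv_con_def[of A] inv_con_def[of B])
qed

lemma inv_con_induced_sub: "inv_con A\<beta> f\<beta> \<chi> \<subseteq> carr A\<beta> \<times> carr A\<beta>"
  by (auto simp: inv_con_def)

lemma Spec_sub: "\<chi> \<in> Spec \<sigma> M \<Longrightarrow> \<chi> \<subseteq> carr M \<times> carr M"
  unfolding Spec_def using ConD(1) by blast

lemma pull_A_cancel:
  assumes "\<phi> \<in> Spec \<sigma> A\<beta>" "pull_A (inv_con A\<beta> f\<beta> \<chi>) = pull_A \<phi>"
  shows "inv_con A\<beta> f\<beta> \<chi> = \<phi>"
  using assms(2) inv_con_induced_sub Spec_sub[OF assms(1)]
  by (intro inj_onD[OF qA.inv_con_inj]) auto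

text \<open>\<open>pull_A\<close> is injective on relations over the quotient, so the equality may
  be tested after pulling back to \<open>A\<close>, where \<open>Spec_A\<close> and
  \<open>Spec_B\<close> identify both sides. One inclusion then always holds, by
  \<open>inv_con_Vset_le\<close>.\<close>

lemma image_induced_iff:
  "inv_con A\<beta> f\<beta> ` Spec \<sigma> B\<beta> = Spec \<sigma> A\<beta> \<longleftrightarrow>
    Vset \<sigma> A (inv_con A f \<beta>) \<subseteq> inv_con A f ` Vset \<sigma> B \<beta>"
proof -
  have "inv_con A\<beta> f\<beta> ` Spec \<sigma> B\<beta> = Spec \<sigma> A\<beta> \<longleftrightarrow>
      pull_A ` inv_con A\<beta> f\<beta> ` Spec \<sigma> B\<beta> = pull_A ` Spec \<sigma> A\<beta>"
    by (intro inj_on_image_eq_iff[OF qA.inv_con_inj, symmetric])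
      (use inv_con_induced_sub Spec_sub in blast)+
  also have "pull_A ` inv_con A\<beta> f\<beta> ` Spec \<sigma> B\<beta> = inv_con A f ` pull_B ` Spec \<sigma> B\<beta>"
    unfolding image_image pull_induced ..
  also have "\<dots> = inv_con A f ` Vset \<sigma> B \<beta>" unfolding Spec_B ..
  also have "pull_A ` Spec \<sigma> A\<beta> = Vset \<sigma> A (inv_con A f \<beta>)" by (rule Spec_A)
  finally show ?thesis using inv_con_Vset_le[of \<beta>] by blast
qed

text \<open>The kernel of \<open>f\<beta>\<close> pulls back to \<open>inv_con A f \<beta>\<close>
  and hence lies below every prime of \<open>A\<beta>\<close>. Lying Over for
  \<open>f\<beta>\<close> thus says that its map of spectra is surjective.\<close>

lemma LO_induced_iff:
  "LO \<sigma> A\<beta> B\<beta> f\<beta> \<longleftrightarrow> Vset \<sigma> A (inv_con A f \<beta>) \<subseteq> inv_con A f ` Vset \<sigma> B \<beta>"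
proof -
  have "Ker A\<beta> B\<beta> f\<beta> \<subseteq> \<phi>" if "\<phi> \<in> Spec \<sigma> A\<beta>" for \<phi>
  proof -
    have "pull_A \<phi> \<in> Vset \<sigma> A (inv_con A f \<beta>)" unfolding Spec_A[symmetric] using that by (rule imageI)
    moreover have "pull_A (Ker A\<beta> B\<beta> f\<beta>) = inv_con A f \<beta>"
      unfolding Ker_def pull_induced Ker_quotient[OF \<beta>, unfolded Ker_def] ..
    ultimately have "pull_A (Ker A\<beta> B\<beta> f\<beta>) \<subseteq> pull_A \<phi>" by (simp add: Vset_def)
    then show ?thesis
      by (subst (asm) qA.inv_con_le_iff) (simp_all add: Ker_def inv_con_induced_sub)
  qed
  then have LO: "LO \<sigma> A\<beta> B\<beta> f\<beta> \<longleftrightarrow> Spec \<sigma> A\<beta> \<subseteq> inv_con A\<beta> f\<beta> ` Spec \<sigma> B\<beta>"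
    unfolding LO_def by blast
  show ?thesis
  proof
    assume "LO \<sigma> A\<beta> B\<beta> f\<beta>"
    then have "pull_A ` Spec \<sigma> A\<beta> \<subseteq> pull_A ` inv_con A\<beta> f\<beta> ` Spec \<sigma> B\<beta>"
      unfolding LO by (rule image_mono)
    also have "\<dots> = inv_con A f ` pull_B ` Spec \<sigma> B\<beta>" unfolding image_image pull_induced ..
    finally show "Vset \<sigma> A (inv_con A f \<beta>) \<subseteq> inv_con A f ` Vset \<sigma> B \<beta>"
      unfolding Spec_A Spec_B .
  next
    assume "Vset \<sigma> A (inv_con A f \<beta>) \<subseteq> inv_con A f ` Vset \<sigma> B \<beta>"
    then show "LO \<sigma> A\<beta> B\<beta> f\<beta>"
      unfolding LO image_induced_iff[symmetric] by simp
  qed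
qed

text \<open>Primes of the quotients are the primes above \<open>\<beta>\<close> and above
  \<open>inv_con A f \<beta>\<close>, with the same inclusions, so this is the criterion of
  \<open>GU_iff\<close> restricted to \<open>Vset \<sigma> B \<beta>\<close>.\<close>

lemma GU_induced_iff:
  "GU \<sigma> A\<beta> B\<beta> f\<beta> \<longleftrightarrow> (\<forall>\<phi>\<in>Vset \<sigma> B \<beta>. Vset \<sigma> A (inv_con A f \<phi>) \<subseteq> inv_con A f ` Vset \<sigma> B \<phi>)"
  (is "_ \<longleftrightarrow> ?R")
proof
  assume G: "GU \<sigma> A\<beta> B\<beta> f\<beta>"
  show ?R
  proof (intro ballI subsetI)
    fix \<phi> \<psi> assume \<phi>: "\<phi> \<in> Vset \<sigma> B \<beta>" and \<psi>: "\<psi> \<in> Vset \<sigma> A (inv_con A f \<phi>)"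
    obtain \<chi> where \<chi>: "\<chi> \<in> Spec \<sigma> B\<beta>" "\<phi> = pull_B \<chi>" using \<phi> unfolding Spec_B[symmetric] by blast
    \<comment> \<open>Admissibility enters through \<open>inv_con_Vset_le\<close>: the pullback is a
      prime above \<open>inv_con A f \<beta>\<close>, so it comes from a prime \<open>\<xi>\<close>
      of \<open>A\<beta>\<close>.\<close>
    have "inv_con A f \<phi> \<in> Vset \<sigma> A (inv_con A f \<beta>)" using inv_con_Vset_le \<phi> by blast
    then obtain \<xi> where \<xi>: "\<xi> \<in> Spec \<sigma> A\<beta>" "inv_con A f \<phi> = pull_A \<xi>"
      unfolding Spec_A[symmetric] by blast
    have \<xi>_eq: "inv_con A\<beta> f\<beta> \<chi> = \<xi>"
      using \<xi> \<chi>(2) by (intro pull_A_cancel) (simp_all add: pull_induced)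
    have "inv_con A f \<beta> \<subseteq> inv_con A f \<phi>" using \<phi> by (intro inv_con_mono) (simp add: Vset_def)
    then have "\<psi> \<in> Vset \<sigma> A (inv_con A f \<beta>)" using \<psi> by (auto simp: Vset_def)
    then obtain \<psi>' where \<psi>': "\<psi>' \<in> Spec \<sigma> A\<beta>" "\<psi> = pull_A \<psi>'" unfolding Spec_A[symmetric] by blast
    have "pull_A \<xi> \<subseteq> pull_A \<psi>'" using \<psi> \<xi>(2) \<psi>'(2) by (simp add: Vset_def)
    then have "\<xi> \<subseteq> \<psi>'" using qA.inv_con_le_iff[OF Spec_sub[OF \<xi>(1)]] by simp
    then obtain \<chi>' where \<chi>': "\<chi>' \<in> Spec \<sigma> B\<beta>" "\<chi> \<subseteq> \<chi>'" "inv_con A\<beta> f\<beta> \<chi>' = \<psi>'"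
      using G \<chi>(1) \<xi>(1) \<psi>'(1) \<xi>_eq unfolding GU_def by blast
    have "pull_B \<chi>' \<in> Vset \<sigma> B \<beta>" unfolding Spec_B[symmetric] using \<chi>'(1) by (rule imageI)
    then have "pull_B \<chi>' \<in> Vset \<sigma> B \<phi>"
      using inv_con_mono[OF \<chi>'(2)] \<chi>(2) by (simp add: Vset_def)
    moreover have "inv_con A f (pull_B \<chi>') = \<psi>"
      using pull_induced[of \<chi>'] \<chi>'(3) \<psi>'(2) by simp
    ultimately show "\<psi> \<in> inv_con A f ` Vset \<sigma> B \<phi>" by blast
  qed
next
  assume R: ?R
  show "GU \<sigma> A\<beta> B\<beta> f\<beta>"
    unfolding GU_def
  proof (intro ballI impI, elim conjE)
    fix \<xi> \<psi> \<chi>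
    assume \<psi>: "\<psi> \<in> Spec \<sigma> A\<beta>" and \<chi>: "\<chi> \<in> Spec \<sigma> B\<beta>" and "\<xi> \<subseteq> \<psi>" "inv_con A\<beta> f\<beta> \<chi> = \<xi>"
    then have "inv_con A f (pull_B \<chi>) \<subseteq> pull_A \<psi>"
      unfolding pull_induced[symmetric] by (intro inv_con_mono) simp
    moreover have "pull_A \<psi> \<in> Vset \<sigma> A (inv_con A f \<beta>)" unfolding Spec_A[symmetric] using \<psi> by (rule imageI)
    ultimately have "pull_A \<psi> \<in> Vset \<sigma> A (inv_con A f (pull_B \<chi>))" by (simp add: Vset_def)
    moreover have \<chi>_V: "pull_B \<chi> \<in> Vset \<sigma> B \<beta>" unfolding Spec_B[symmetric] using \<chi> by (rule imageI)
    ultimately obtain \<phi> where \<phi>: "\<phi> \<in> Vset \<sigma> B (pull_B \<chi>)" "pull_A \<psi> = inv_con A f \<phi>"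
      using R by blast
    then have "\<phi> \<in> Vset \<sigma> B \<beta>" using \<chi>_V by (auto simp: Vset_def)
    then obtain \<chi>' where \<chi>': "\<chi>' \<in> Spec \<sigma> B\<beta>" "\<phi> = pull_B \<chi>'" unfolding Spec_B[symmetric] by blast
    have "inv_con A\<beta> f\<beta> \<chi>' = \<psi>"
      using \<psi> \<phi>(2) \<chi>'(2) by (intro pull_A_cancel) (simp_all add: pull_induced)
    moreover have "\<chi> \<subseteq> \<chi>'"
      using \<phi>(1) \<chi>'(2) qB.inv_con_le_iff[OF Spec_sub[OF \<chi>]] by (simp add: Vset_def)
    ultimately show "\<exists>\<psi>\<^sub>1\<in>Spec \<sigma> B\<beta>. \<chi> \<subseteq> \<psi>\<^sub>1 \<and> inv_con A\<beta> f\<beta> \<psi>\<^sub>1 = \<psi>" using \<chi>'(1) by blast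
  qed
qed

end

end

theorem proposition7p3:
  fixes \<sigma> :: "'f signat" and E :: "'f identities"
    and A :: "('f, 'a) alg" and B :: "('f, 'b) alg" and f :: "'a \<Rightarrow> 'b"
  assumes "wf_identities \<sigma> E" and "congruence_modular \<sigma> E"
    and "in_class \<sigma> E A" and "in_class \<sigma> E B"
    and "morphism \<sigma> A B f" and "admissible_mor \<sigma> A B f"
  shows
    "(fin_generated \<sigma> B (Nabla B) \<longrightarrow>
      all_equivalent
       [GU \<sigma> A B f,
        \<forall>\<beta>\<in>Spec \<sigma> B. inv_con (quot_alg A (inv_con A f \<beta>)) (induced f \<beta>) ` Spec \<sigma> (quot_alg B \<beta>)
                      = Spec \<sigma> (quot_alg A (inv_con A f \<beta>)),
        closed_map (stone \<sigma> B) (stone \<sigma> A) (inv_con A f),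
        \<forall>\<beta>\<in>Con \<sigma> B. GU \<sigma> (quot_alg A (inv_con A f \<beta>)) (quot_alg B \<beta>) (induced f \<beta>),
        \<forall>\<beta>\<in>Con \<sigma> B. LO \<sigma> (quot_alg A (inv_con A f \<beta>)) (quot_alg B \<beta>) (induced f \<beta>),
        \<forall>\<beta>\<in>Spec \<sigma> B. GU \<sigma> (quot_alg A (inv_con A f \<beta>)) (quot_alg B \<beta>) (induced f \<beta>),
        \<forall>\<beta>\<in>Spec \<sigma> B. LO \<sigma> (quot_alg A (inv_con A f \<beta>)) (quot_alg B \<beta>) (induced f \<beta>)])
     \<and>
      all_equivalent
       [GU \<sigma> A B f,
        \<forall>\<beta>\<in>Spec \<sigma> B. inv_con (quot_alg A (inv_con A f \<beta>)) (induced f \<beta>) ` Spec \<sigma> (quot_alg B \<beta>)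
                      = Spec \<sigma> (quot_alg A (inv_con A f \<beta>)),
        \<forall>\<beta>\<in>Con \<sigma> B. GU \<sigma> (quot_alg A (inv_con A f \<beta>)) (quot_alg B \<beta>) (induced f \<beta>),
        \<forall>\<beta>\<in>Spec \<sigma> B. LO \<sigma> (quot_alg A (inv_con A f \<beta>)) (quot_alg B \<beta>) (induced f \<beta>)]"
proof -
  interpret admissible_morphism \<sigma> E A B f
    using assms by unfold_locales
  have con: "\<beta> \<in> Con \<sigma> B" if "\<beta> \<in> Spec \<sigma> B" for \<beta> using that by (simp add: Spec_def)
  \<comment> \<open>Each of the other conditions is shown equivalent to
    \<open>GU \<sigma> A B f\<close>. For (2) and (7) the inclusion in \<open>GU_iff\<close> is
    matched prime by prime.\<close>
  have 2: "(\<forall>\<beta>\<in>Spec \<sigma> B. inv_con (quot_alg A (inv_con A f \<beta>)) (induced f \<beta>) ` Spec \<sigma> (quot_alg B \<beta>)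
      = Spec \<sigma> (quot_alg A (inv_con A f \<beta>))) \<longleftrightarrow> GU \<sigma> A B f"
    unfolding GU_iff using image_induced_iff[OF con] by simp
  have 7: "(\<forall>\<beta>\<in>Spec \<sigma> B. LO \<sigma> (quot_alg A (inv_con A f \<beta>)) (quot_alg B \<beta>) (induced f \<beta>))
      \<longleftrightarrow> GU \<sigma> A B f" (is "?LO \<longleftrightarrow> _")
    unfolding GU_iff using LO_induced_iff[OF con] by simp
  have 5: "(\<forall>\<beta>\<in>Con \<sigma> B. LO \<sigma> (quot_alg A (inv_con A f \<beta>)) (quot_alg B \<beta>) (induced f \<beta>))
      \<longleftrightarrow> GU \<sigma> A B f" (is "?LO' \<longleftrightarrow> _")
  proof
    show "GU \<sigma> A B f" if ?LO' unfolding 7[symmetric] using that con by simp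
    show ?LO' if "GU \<sigma> A B f" using Vset_le_of_GU[OF that] LO_induced_iff by simp
  qed
  have up: "GU \<sigma> (quot_alg A (inv_con A f \<beta>)) (quot_alg B \<beta>) (induced f \<beta>)"
    if "GU \<sigma> A B f" "\<beta> \<in> Con \<sigma> B" for \<beta>
    unfolding GU_induced_iff[OF that(2)] using that(1) by (simp add: GU_iff Vset_def)
  \<comment> \<open>A prime \<open>\<beta>\<close> is a member of its own \<open>Vset\<close>, so
    the criterion for its induced morphism, taken at \<open>\<phi> = \<beta>\<close>, is the
    inclusion that \<open>GU_iff\<close> demands.\<close>
  have down: "GU \<sigma> A B f"
    if "\<forall>\<beta>\<in>Spec \<sigma> B. GU \<sigma> (quot_alg A (inv_con A f \<beta>)) (quot_alg B \<beta>) (induced f \<beta>)"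
    unfolding GU_iff
  proof
    fix \<beta> assume \<beta>: "\<beta> \<in> Spec \<sigma> B"
    then have "\<beta> \<in> Vset \<sigma> B \<beta>" by (simp add: Vset_def)
    then show "Vset \<sigma> A (inv_con A f \<beta>) \<subseteq> inv_con A f ` Vset \<sigma> B \<beta>"
      using bspec[OF that \<beta>] unfolding GU_induced_iff[OF con[OF \<beta>]] by (rule bspec[rotated])
  qed
  have 4: "(\<forall>\<beta>\<in>Con \<sigma> B. GU \<sigma> (quot_alg A (inv_con A f \<beta>)) (quot_alg B \<beta>) (induced f \<beta>))
      \<longleftrightarrow> GU \<sigma> A B f"
    using up down con by metis
  have 6: "(\<forall>\<beta>\<in>Spec \<sigma> B. GU \<sigma> (quot_alg A (inv_con A f \<beta>)) (quot_alg B \<beta>) (induced f \<beta>))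
      \<longleftrightarrow> GU \<sigma> A B f"
    using up down con by metis
  show ?thesis
    unfolding 2 4 5 6 7 closed_map_iff_GU by (simp add: all_equivalent_def)
qed

end
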